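(* Let $p>3$ be a prime, let $q\ge3$ be an integer with $|q|_p\le p^{-3}$, and let $\rho\in\mathcal{E}_p$ satisfy $|\rho-1|_p\le p^{-3}$. Let $\mu_0,\mu_1,\mu_2,\mu_3$ be the translation-invariant $p$-adic Gibbs measures of the $q$-state $p$-adic Potts model on the Cayley tree of order three corresponding to the solutions $x_0=1$ and $x_1,x_2,x_3\in\mathcal{E}_p$ (the three roots of the cubic $x^3-Ax^2-Bx+C=0$) of the fixed point equation on the invariant line. Then the measures $\mu_k$, $k=0,1,2,3$, are unbounded. Moreover, there is a phase transition.
   Context: $\mathbb{Q}_p$ is the field of $p$-adic numbers with norm $|\cdot|_p$, $|p|_p=1/p$. $\mathcal{E}_p=\{x\in\mathbb{Q}_p: |x|_p=1,\ |x-1|_p<p^{-1/(p-1)}\}$. Tree. $\Gamma^3_+=(V,L)$ is the semi-infinite Cayley tree of order three with root $x^0$: the infinite rooted tree in which every vertex has exactly three direct successors. $W_n$ is the set of vertices at distance $n$ from $x^0$, $V_n=\bigcup_{m=0}^n W_m$, and $L_n$ is the set of edges $\langle x,y\rangle$ with $x,y\in V_n$. Potts model. The state space is $\Phi=\{0,1,\dots,q-1\}$, and $\Omega=\Phi^V$, $\Omega_{V_n}=\Phi^{V_n}$, $\Omega_{W_n}=\Phi^{W_n}$. The Hamiltonian is $H_n(\sigma)=\sum_{\langle x,y\rangle\in L_n}\delta_{\sigma(x),\sigma(y)}$ for $\sigma\in\Omega_{V_n}$ ($\delta$ is the Kronecker symbol). Measures. A $p$-adic (probability) measure is a finitely additive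 $\mathbb{Q}_p$-valued function $\mu$ on an algebra $\mathcal{B}$ of sets (with total mass $1$); it is bounded if $\sup\{|\mu(A)|_p:A\in\mathcal{B}\}<\infty$ and unbounded otherwise. Given $\rho\in\mathbb{Q}_p$ and a function $\mathbf{h}:V\setminus\{x^0\}\to\mathbb{Q}_p^{\Phi}$, $\mathbf{h}_x=(h_{0,x},\dots,h_{q-1,x})$, normalized (without loss of generality) by $h_{0,x}=1$, define for $n\ge 1$ and $\sigma\in\Omega_{V_n}$ $$\mu^{(n)}_{\mathbf{h},\rho}(\sigma)=\frac{1}{Z^{(\mathbf{h})}_{n,\rho}}\,\rho^{H_n(\sigma)}\prod_{x\in W_n}h_{\sigma(x),x},\qquad Z^{(\mathbf{h})}_{n,\rho}=\sum_{\sigma\in\Omega_{V_n}}\rho^{H_n(\sigma)}\prod_{x\in W_n}h_{\sigma(x),x}.$$ If these are compatible, i.e. $\sum_{\omega\in\Omega_{W_n}}\mu^{(n)}_{\mathbf{h},\rho}(\sigma_{n-1}\vee\omega)=\mu^{(n-1)}_{\mathbf{h},\rho}(\sigma_{n-1})$ for all $n\geq 2$ and $\sigma_{n-1}\in\Omega_{V_{n-1}}$ (where $\sigma_{n-1}\vee\omega$ is the concatenated configuration on $V_n$), then there is a unique $p$-adic probability measure $\mu_{\mathbf{h},\rho}$ on the algebra of cylinder subsets of $\Omega$ with $\mu_{\mathbf{h},\rho}(\{\sigma:\sigma|_{V_n}=\sigma_n\})=\mu^{(n)}_{\mathbf{h},\rho}(\sigma_n)$ for all $n\ge1$, $\sigma_n\in\Omega_{V_n}$.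 Such $\mu_{\mathbf{h},\rho}$ is called a generalized $p$-adic quasi Gibbs measure. It is called a $p$-adic Gibbs measure if $\rho\in\mathcal{E}_p$ and all $h_{i,x}\in\mathcal{E}_p$. It is called translation-invariant if $\mathbf{h}_x$ does not depend on $x\in V\setminus\{x^0\}$. Invariant line. Fix $i_0\in\{1,\dots,q-1\}$. The translation-invariant function with $h_{i_0,x}=h$ and $h_{i,x}=1$ for $i\ne i_0$ (all $x\in V\setminus\{x^0\}$) gives compatible measures iff $h\in\mathbb{Q}_p$ solves the fixed point equation $h=\big(\frac{\rho h+q-1}{h+\rho+q-2}\big)^3$; the resulting measure is said to correspond to the solution $h$. The fixed point equation is equivalent to $(x-1)(x^3-Ax^2-Bx+C)=0$ with $$A=\rho^3-3\rho-3q+5,\quad B=\rho(\rho-3)^2+9q+3\rho q(\rho-2)-3q^2-7,\quad C=(q-1)^3.$$ The paper asserts, for every prime $p>3$, every integer $q\ge3$ with $|q|_p\le p^{-3}$ and every $\rho\in\mathcal{E}_p$ with $|\rho-1|_p\le p^{-3}$, that the cubic $x^3-Ax^2-Bx+C=0$ has three solutions in $\mathcal{E}_p$. Phase transition. A phase transition occurs if there are at least two distinct generalized $p$-adic quasi Gibbs measures (for the given $\rho$) such that at least one of them is unbounded.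
   Formalization: The phase transition is claimed only for ρ ≠ 1 (at ρ = 1 there is just one generalized quasi Gibbs measure); a root x_k counts only if x_k+ρ+q-2 ≠ 0 (it fails only at ρ = 1 or ρ = 1-q, where Z_n = 0 and μ_k is undefined). *)

theory Defs
  imports "HOL-Analysis.Analysis" "Berlekamp_Zassenhaus.Finite_Field"
begin

section \<open>The field of p-adic numbers\<close>

subsection \<open>The p-adic absolute value on the rationals\<close>

definition padic_abs :: "nat \<Rightarrow> rat \<Rightarrow> real" where
  "padic_abs p x = (if x = 0 then 0 else
     real p powi (int (multiplicity (int p) (snd (quotient_of x)))
                  - int (multiplicity (int p) (fst (quotient_of x)))))"

lemma padic_abs_0 [simp]: "padic_abs p 0 = 0"
  by (simp add: padic_abs_def)

lemma padic_abs_nonneg [simp]: "padic_abs p x \<ge> 0"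
  by (simp add: padic_abs_def)

lemma padic_abs_fract:
  assumes p: "prime p" and nz: "a \<noteq> 0" "b \<noteq> 0"
  shows "padic_abs p (of_int a / of_int b)
           = real p powi (int (multiplicity (int p) b) - int (multiplicity (int p) a))"
proof -
  obtain c d where cd: "quotient_of (of_int a / of_int b) = (c, d)"
    by (cases "quotient_of (of_int a / of_int b)")
  have d: "d > 0" using quotient_of_denom_pos[OF cd] .
  have eq: "of_int a / of_int b = (of_int c / of_int d :: rat)"
    using quotient_of_div[OF cd] .
  with nz d have c: "c \<noteq> 0" by auto
  from eq nz d have "(of_int (a * d) :: rat) = of_int (c * b)"
    by (simp add: field_simps)
  then have ad: "a * d = c * b" by (simp only: of_int_eq_iff)
  have "prime_elem (int p)" using p by simp
  then have "multiplicity (int p) a + multiplicity (int p) d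
      = multiplicity (int p) c + multiplicity (int p) b"
    using arg_cong[OF ad, of "multiplicity (int p)"] nz c d
    by (simp add: prime_elem_multiplicity_mult_distrib)
  then have "int (multiplicity (int p) d) - int (multiplicity (int p) c)
      = int (multiplicity (int p) b) - int (multiplicity (int p) a)"
    by linarith
  then show ?thesis
    using nz by (simp add: padic_abs_def cd)
qed

lemma padic_abs_eq_0_iff:
  assumes "prime p"
  shows "padic_abs p x = 0 \<longleftrightarrow> x = 0"
  using prime_gt_0_nat[OF assms] by (simp add: padic_abs_def)

lemma padic_abs_1:
  assumes "prime p"
  shows "padic_abs p 1 = 1"
  using padic_abs_fract[OF assms, of 1 1] by simp

lemma rat_cases_fract:
  obtains a b :: int where "b \<noteq> 0" "x = of_int a / (of_int b :: rat)"
proof -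
  obtain c d where cd: "quotient_of x = (c, d)"
    by (cases "quotient_of x")
  show ?thesis
    using that[of d c] quotient_of_denom_pos[OF cd] quotient_of_div[OF cd] by auto
qed

lemma padic_abs_mult:
  assumes p: "prime p"
  shows "padic_abs p (x * y) = padic_abs p x * padic_abs p y"
proof (cases "x = 0 \<or> y = 0")
  case False
  obtain a b where ab: "b \<noteq> 0" "x = of_int a / of_int b" by (rule rat_cases_fract)
  obtain c d where cd: "d \<noteq> 0" "y = of_int c / of_int d" by (rule rat_cases_fract)
  have nz: "a \<noteq> 0" "c \<noteq> 0" using False ab cd by auto
  have pe: "prime_elem (int p)" using p by simp
  have p0: "real p \<noteq> 0" using prime_gt_0_nat[OF p] by simp
  have "x * y = of_int (a * c) / of_int (b * d)" using ab cd by simp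
  then have "padic_abs p (x * y)
      = real p powi (int (multiplicity (int p) (b * d)) - int (multiplicity (int p) (a * c)))"
    using padic_abs_fract[OF p, of "a * c" "b * d"] nz ab cd by simp
  also have "\<dots> = real p powi ((int (multiplicity (int p) b) - int (multiplicity (int p) a))
                   + (int (multiplicity (int p) d) - int (multiplicity (int p) c)))"
    using nz ab cd
    by (simp add: prime_elem_multiplicity_mult_distrib[OF pe] algebra_simps)
  also have "\<dots> = padic_abs p x * padic_abs p y"
    using padic_abs_fract[OF p nz(1) ab(1)] padic_abs_fract[OF p nz(2) cd(1)] ab cd p0
    by (simp add: power_int_add)
  finally show ?thesis .
qed auto

lemma padic_abs_minus:
  assumes p: "prime p"
  shows "padic_abs p (- x) = padic_abs p x"
proof -
  have "padic_abs p (-1) = 1"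
    using padic_abs_fract[OF p, of "-1" 1] by (simp add: multiplicity_unit_right)
  then show ?thesis
    using padic_abs_mult[OF p, of "-1" x] by simp
qed

lemma padic_abs_minus_commute:
  assumes "prime p"
  shows "padic_abs p (x - y) = padic_abs p (y - x)"
  using padic_abs_minus[OF assms, of "x - y"] by simp

lemma padic_abs_add:
  assumes p: "prime p"
  shows "padic_abs p (x + y) \<le> max (padic_abs p x) (padic_abs p y)"
proof (cases "x = 0 \<or> y = 0 \<or> x + y = 0")
  case True
  then show ?thesis by (auto simp: le_max_iff_disj)
next
  case False
  obtain a b where ab: "b \<noteq> 0" "x = of_int a / of_int b" by (rule rat_cases_fract)
  obtain c d where cd: "d \<noteq> 0" "y = of_int c / of_int d" by (rule rat_cases_fract)
  have pe: "prime_elem (int p)" using p by simp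
  have nunit: "\<not> is_unit (int p)" using pe prime_elem_not_unit by blast
  have p1: "1 \<le> real p" using prime_gt_0_nat[OF p] by simp
  define m e where "m = a * d" and "e = b * c"
  have x: "x = of_int m / of_int (b * d)" and y: "y = of_int e / of_int (b * d)"
    using ab cd by (simp_all add: m_def e_def)
  have bd: "b * d \<noteq> 0" using ab cd by simp
  have xy: "x + y = of_int (m + e) / of_int (b * d)"
    using x y by (simp add: add_divide_distrib)
  have nz: "m \<noteq> 0" "e \<noteq> 0" "m + e \<noteq> 0" using False x y xy by auto
  let ?v = "multiplicity (int p)"
  have "int p ^ min (?v m) (?v e) dvd m" "int p ^ min (?v m) (?v e) dvd e"
    by (rule multiplicity_dvd', simp)+
  then have "int p ^ min (?v m) (?v e) dvd m + e" by (rule dvd_add)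
  then have le: "min (?v m) (?v e) \<le> ?v (m + e)"
    using nz nunit by (intro multiplicity_geI) auto
  have eqs: "padic_abs p x = real p powi (int (?v (b * d)) - int (?v m))"
      "padic_abs p y = real p powi (int (?v (b * d)) - int (?v e))"
      "padic_abs p (x + y) = real p powi (int (?v (b * d)) - int (?v (m + e)))"
    unfolding x y xy[unfolded x y]
    using padic_abs_fract[OF p _ bd] nz by blast+
  consider "?v m \<le> ?v (m + e)" | "?v e \<le> ?v (m + e)"
    using le by linarith
  then show ?thesis
  proof cases
    case 1
    then have "padic_abs p (x + y) \<le> padic_abs p x"
      unfolding eqs using p1 by (intro power_int_increasing) auto
    then show ?thesis by simp
  next
    case 2
    then have "padic_abs p (x + y) \<le> padic_abs p y"
      unfolding eqs using p1 by (intro power_int_increasing) auto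
    then show ?thesis by simp
  qed
qed

lemma padic_abs_triangle:
  assumes "prime p"
  shows "padic_abs p (x + y) \<le> padic_abs p x + padic_abs p y"
  using padic_abs_add[OF assms, of x y] padic_abs_nonneg[of p x] padic_abs_nonneg[of p y]
  by linarith

lemma padic_abs_diff_abs:
  assumes p: "prime p"
  shows "\<bar>padic_abs p x - padic_abs p y\<bar> \<le> padic_abs p (x - y)"
  using padic_abs_triangle[OF p, of "x - y" y] padic_abs_triangle[OF p, of "y - x" x]
    padic_abs_minus_commute[OF p, of x y] by simp

lemma padic_abs_inverse:
  assumes p: "prime p"
  shows "padic_abs p (inverse x) = inverse (padic_abs p x)"
proof (cases "x = 0")
  case False
  then have "padic_abs p (inverse x) * padic_abs p x = 1"
    by (simp add: padic_abs_mult[OF p, symmetric] padic_abs_1[OF p])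
  then show ?thesis
    by (metis inverse_unique mult.commute)
qed simp


subsection \<open>Cauchy sequences and null sequences\<close>

definition padic_null :: "nat \<Rightarrow> (nat \<Rightarrow> rat) \<Rightarrow> bool" where
  "padic_null p X \<longleftrightarrow> (\<lambda>n. padic_abs p (X n)) \<longlonglongrightarrow> 0"

definition padic_cauchy :: "nat \<Rightarrow> (nat \<Rightarrow> rat) \<Rightarrow> bool" where
  "padic_cauchy p X \<longleftrightarrow> (\<forall>e>0. \<exists>k. \<forall>m\<ge>k. \<forall>n\<ge>k. padic_abs p (X m - X n) < e)"

lemma padic_null_0 [simp]: "padic_null p (\<lambda>n. 0)"
  by (simp add: padic_null_def)

lemma padic_null_le:
  assumes "eventually (\<lambda>n. padic_abs p (X n) \<le> f n) sequentially" "f \<longlonglongrightarrow> 0"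
  shows "padic_null p X"
  unfolding padic_null_def
  by (rule real_tendsto_sandwich[OF _ assms(1) tendsto_const assms(2)]) simp

lemma padic_null_add:
  assumes p: "prime p" and "padic_null p X" "padic_null p Y"
  shows "padic_null p (\<lambda>n. X n + Y n)"
proof (rule padic_null_le)
  show "eventually (\<lambda>n. padic_abs p (X n + Y n) \<le> padic_abs p (X n) + padic_abs p (Y n)) sequentially"
    by (simp add: padic_abs_triangle[OF p])
  show "(\<lambda>n. padic_abs p (X n) + padic_abs p (Y n)) \<longlonglongrightarrow> 0"
    using assms(2,3) unfolding padic_null_def by (rule tendsto_add_zero)
qed

lemma padic_null_minus:
  assumes p: "prime p" and "padic_null p X"
  shows "padic_null p (\<lambda>n. - X n)"
  using assms by (simp add: padic_null_def padic_abs_minus)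

lemma padic_cauchy_const [simp]: "padic_cauchy p (\<lambda>n. c)"
  by (simp add: padic_cauchy_def)

lemma padic_cauchy_add:
  assumes p: "prime p" and X: "padic_cauchy p X" and Y: "padic_cauchy p Y"
  shows "padic_cauchy p (\<lambda>n. X n + Y n)"
  unfolding padic_cauchy_def
proof (intro allI impI)
  fix e :: real assume e: "e > 0"
  obtain k where k: "\<forall>m\<ge>k. \<forall>n\<ge>k. padic_abs p (X m - X n) < e"
    using X e unfolding padic_cauchy_def by blast
  obtain l where l: "\<forall>m\<ge>l. \<forall>n\<ge>l. padic_abs p (Y m - Y n) < e"
    using Y e unfolding padic_cauchy_def by blast
  have "padic_abs p (X m + Y m - (X n + Y n)) < e" if "m \<ge> max k l" "n \<ge> max k l" for m n
  proof -
    have "padic_abs p (X m + Y m - (X n + Y n))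
        \<le> max (padic_abs p (X m - X n)) (padic_abs p (Y m - Y n))"
      using padic_abs_add[OF p, of "X m - X n" "Y m - Y n"] by (simp add: algebra_simps)
    then show ?thesis using k l that by fastforce
  qed
  then show "\<exists>k. \<forall>m\<ge>k. \<forall>n\<ge>k. padic_abs p (X m + Y m - (X n + Y n)) < e" by blast
qed

lemma padic_cauchy_minus:
  assumes p: "prime p" and X: "padic_cauchy p X"
  shows "padic_cauchy p (\<lambda>n. - X n)"
proof -
  have "padic_abs p (- a - - b) = padic_abs p (a - b)" for a b
    using padic_abs_minus_commute[OF p, of a b] by simp
  then show ?thesis using X by (simp add: padic_cauchy_def)
qed

lemma padic_cauchy_abs_Cauchy:
  assumes p: "prime p" and X: "padic_cauchy p X"
  shows "Cauchy (\<lambda>n. padic_abs p (X n))"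
  unfolding Cauchy_def dist_real_def
  using X padic_abs_diff_abs[OF p] unfolding padic_cauchy_def
  by (meson le_less_trans)

lemma padic_cauchy_abs_tendsto:
  assumes "prime p" and "padic_cauchy p X"
  shows "(\<lambda>n. padic_abs p (X n)) \<longlonglongrightarrow> lim (\<lambda>n. padic_abs p (X n))"
  using padic_cauchy_abs_Cauchy[OF assms] by (simp add: Cauchy_convergent_iff convergent_LIMSEQ_iff)

lemma padic_cauchy_bounded:
  assumes p: "prime p" and X: "padic_cauchy p X"
  shows "\<exists>b>0. \<forall>n. padic_abs p (X n) < b"
proof -
  have "Bseq (\<lambda>n. padic_abs p (X n))"
    using padic_cauchy_abs_Cauchy[OF p X] by (rule Cauchy_Bseq)
  then obtain b where b: "b > 0" "\<forall>n. norm (padic_abs p (X n)) \<le> b" by (auto elim: BseqE)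
  have "padic_abs p (X n) < b + 1" for n using spec[OF b(2), of n] by simp
  then show ?thesis using b(1) by (intro exI[of _ "b + 1"]) auto
qed

lemma padic_null_mult_bounded:
  assumes p: "prime p" and X: "padic_cauchy p X" and Y: "padic_null p Y"
  shows "padic_null p (\<lambda>n. X n * Y n)"
proof -
  obtain b where b: "b > 0" "\<forall>n. padic_abs p (X n) < b"
    using padic_cauchy_bounded[OF p X] by blast
  show ?thesis
  proof (rule padic_null_le)
    show "eventually (\<lambda>n. padic_abs p (X n * Y n) \<le> b * padic_abs p (Y n)) sequentially"
      using less_imp_le[OF spec[OF b(2)]] unfolding padic_abs_mult[OF p]
      by (intro always_eventually allI mult_right_mono) auto
    show "(\<lambda>n. b * padic_abs p (Y n)) \<longlonglongrightarrow> 0"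
      using Y unfolding padic_null_def by (rule tendsto_mult_right_zero)
  qed
qed

lemma padic_cauchy_mult:
  assumes p: "prime p" and X: "padic_cauchy p X" and Y: "padic_cauchy p Y"
  shows "padic_cauchy p (\<lambda>n. X n * Y n)"
  unfolding padic_cauchy_def
proof (intro allI impI)
  fix e :: real assume e: "e > 0"
  obtain a where a: "a > 0" "\<forall>n. padic_abs p (X n) < a"
    using padic_cauchy_bounded[OF p X] by blast
  obtain b where b: "b > 0" "\<forall>n. padic_abs p (Y n) < b"
    using padic_cauchy_bounded[OF p Y] by blast
  obtain k where k: "\<forall>m\<ge>k. \<forall>n\<ge>k. padic_abs p (X m - X n) < e / b"
    using X e b unfolding padic_cauchy_def by (meson divide_pos_pos)
  obtain l where l: "\<forall>m\<ge>l. \<forall>n\<ge>l. padic_abs p (Y m - Y n) < e / a"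
    using Y e a unfolding padic_cauchy_def by (meson divide_pos_pos)
  have "padic_abs p (X m * Y m - X n * Y n) < e" if "m \<ge> max k l" "n \<ge> max k l" for m n
  proof -
    have "padic_abs p (X m * Y m - X n * Y n)
        \<le> max (padic_abs p (X m * (Y m - Y n))) (padic_abs p ((X m - X n) * Y n))"
      using padic_abs_add[OF p, of "X m * (Y m - Y n)" "(X m - X n) * Y n"]
      by (simp add: algebra_simps)
    moreover have "padic_abs p (X m * (Y m - Y n)) < a * (e / a)"
      unfolding padic_abs_mult[OF p] using a l that by (intro mult_strict_mono) auto
    moreover have "padic_abs p ((X m - X n) * Y n) < e / b * b"
      unfolding padic_abs_mult[OF p] using b k e that by (intro mult_strict_mono) auto
    ultimately show ?thesis using a b by simp
  qed
  then show "\<exists>k. \<forall>m\<ge>k. \<forall>n\<ge>k. padic_abs p (X m * Y m - X n * Y n) < e" by blast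
qed

lemma padic_cauchy_not_null:
  assumes p: "prime p" and X: "padic_cauchy p X" and nz: "\<not> padic_null p X"
  shows "\<exists>b>0. \<exists>k. \<forall>n\<ge>k. b < padic_abs p (X n)"
proof -
  let ?L = "lim (\<lambda>n. padic_abs p (X n))"
  have L: "(\<lambda>n. padic_abs p (X n)) \<longlonglongrightarrow> ?L" by (rule padic_cauchy_abs_tendsto[OF p X])
  have "?L \<ge> 0" using L by (rule LIMSEQ_le_const) auto
  moreover have "?L \<noteq> 0" using nz L by (auto simp: padic_null_def)
  ultimately have pos: "?L / 2 > 0" by simp
  then have "eventually (\<lambda>n. ?L / 2 < padic_abs p (X n)) sequentially"
    by (intro order_tendstoD[OF L]) auto
  then show ?thesis using pos unfolding eventually_sequentially by blast
qed

lemma padic_abs_diff_inverse: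
  assumes p: "prime p" and xy: "b > 0" "b < padic_abs p x" "c > 0" "c < padic_abs p y"
  shows "padic_abs p (inverse x - inverse y) \<le> padic_abs p (x - y) / (b * c)"
proof -
  have nz: "x \<noteq> 0" "y \<noteq> 0" using xy by auto
  then have "inverse x - inverse y = (y - x) * inverse (x * y)"
    by (simp add: field_simps)
  then have "padic_abs p (inverse x - inverse y)
      = padic_abs p (x - y) / (padic_abs p x * padic_abs p y)"
    by (simp add: padic_abs_mult[OF p] padic_abs_inverse[OF p] padic_abs_minus_commute[OF p, of x y]
        divide_inverse)
  also have "\<dots> \<le> padic_abs p (x - y) / (b * c)"
    using xy by (intro divide_left_mono mult_mono mult_pos_pos) auto
  finally show ?thesis .
qed

lemma padic_cauchy_inverse:
  assumes p: "prime p" and X: "padic_cauchy p X" and nz: "\<not> padic_null p X"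
  shows "padic_cauchy p (\<lambda>n. inverse (X n))"
  unfolding padic_cauchy_def
proof (intro allI impI)
  fix e :: real assume e: "e > 0"
  obtain b k where b: "b > 0" and k: "\<forall>n\<ge>k. b < padic_abs p (X n)"
    using padic_cauchy_not_null[OF p X nz] by blast
  have "e * (b * b) > 0" using e b by simp
  then obtain l where l: "\<forall>m\<ge>l. \<forall>n\<ge>l. padic_abs p (X m - X n) < e * (b * b)"
    using X unfolding padic_cauchy_def by blast
  have "padic_abs p (inverse (X m) - inverse (X n)) < e" if "m \<ge> max k l" "n \<ge> max k l" for m n
  proof -
    have "padic_abs p (inverse (X m) - inverse (X n)) \<le> padic_abs p (X m - X n) / (b * b)"
      using b k that by (intro padic_abs_diff_inverse[OF p]) auto
    also have "\<dots> < e" using l that b by (simp add: divide_less_eq)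
    finally show ?thesis .
  qed
  then show "\<exists>k. \<forall>m\<ge>k. \<forall>n\<ge>k. padic_abs p (inverse (X m) - inverse (X n)) < e" by blast
qed

lemma padic_null_diff_inverse:
  assumes p: "prime p"
    and X: "padic_cauchy p X" "\<not> padic_null p X"
    and Y: "padic_cauchy p Y" "\<not> padic_null p Y"
    and XY: "padic_null p (\<lambda>n. X n - Y n)"
  shows "padic_null p (\<lambda>n. inverse (X n) - inverse (Y n))"
proof -
  obtain b k where b: "b > 0" and k: "\<forall>n\<ge>k. b < padic_abs p (X n)"
    using padic_cauchy_not_null[OF p X] by blast
  obtain c l where c: "c > 0" and l: "\<forall>n\<ge>l. c < padic_abs p (Y n)"
    using padic_cauchy_not_null[OF p Y] by blast
  show ?thesis
  proof (rule padic_null_le)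
    show "eventually (\<lambda>n. padic_abs p (inverse (X n) - inverse (Y n))
        \<le> padic_abs p (X n - Y n) / (b * c)) sequentially"
      unfolding eventually_sequentially using b c k l
      by (intro exI[of _ "max k l"] allI impI padic_abs_diff_inverse[OF p]) auto
    show "(\<lambda>n. padic_abs p (X n - Y n) / (b * c)) \<longlonglongrightarrow> 0"
      using XY unfolding padic_null_def by (rule tendsto_divide_zero)
  qed
qed


subsection \<open>The completion\<close>

text \<open>
  The prime \<open>p\<close> is the cardinality of the type argument \<open>'p\<close>, so a statement about
  \<open>'p padic\<close> with \<open>'p\<close> of class \<open>prime_card\<close> is a statement about every prime.
\<close>

definition padicrel :: "'p::prime_card itself \<Rightarrow> (nat \<Rightarrow> rat) \<Rightarrow> (nat \<Rightarrow> rat) \<Rightarrow> bool" where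
  "padicrel T X Y \<longleftrightarrow> padic_cauchy CARD('p) X \<and> padic_cauchy CARD('p) Y \<and>
     padic_null CARD('p) (\<lambda>n. X n - Y n)"

lemma padicrel_refl: "padic_cauchy CARD('p::prime_card) X \<Longrightarrow> padicrel TYPE('p) X X"
  by (simp add: padicrel_def)

lemma part_equivp_padicrel: "part_equivp (padicrel TYPE('p::prime_card))"
proof (rule part_equivpI)
  show "\<exists>X. padicrel TYPE('p) X X"
    by (rule exI[of _ "\<lambda>n. 0"]) (simp add: padicrel_refl)
  show "symp (padicrel TYPE('p))"
    by (auto simp: symp_def padicrel_def padic_null_def padic_abs_minus_commute[OF prime_card])
  show "transp (padicrel TYPE('p))"
    by (rule transpI) (auto simp: padicrel_def dest: padic_null_add[OF prime_card])
qed

text \<open>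
  The command \<open>quotient_type\<close> does not accept a partial relation over a raw type without \<open>'p\<close>;
  the quotient is therefore defined as the set of equivalence classes.
\<close>

typedef (overloaded) ('p::prime_card) padic =
  "{c. \<exists>X. padicrel TYPE('p) X X \<and> c = Collect (padicrel TYPE('p) X)}"
  using part_equivp_typedef[OF part_equivp_padicrel] by blast

definition abs_padic :: "(nat \<Rightarrow> rat) \<Rightarrow> 'p::prime_card padic" where
  "abs_padic = quot_type.abs (padicrel TYPE('p)) Abs_padic"

definition rep_padic :: "'p::prime_card padic \<Rightarrow> (nat \<Rightarrow> rat)" where
  "rep_padic = quot_type.rep Rep_padic"

definition cr_padic :: "(nat \<Rightarrow> rat) \<Rightarrow> 'p::prime_card padic \<Rightarrow> bool" where
  "cr_padic = (\<lambda>X x. padicrel TYPE('p) X X \<and> abs_padic X = x)"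

lemma quot_type_padic:
  "quot_type (padicrel TYPE('p::prime_card)) (Abs_padic :: _ \<Rightarrow> 'p padic) Rep_padic"
proof
  show "part_equivp (padicrel TYPE('p))" by (rule part_equivp_padicrel)
qed (use Rep_padic Abs_padic_inverse in \<open>auto simp: Rep_padic_inverse Rep_padic_inject\<close>)

lemma Quotient_padic:
  "Quotient (padicrel TYPE('p::prime_card)) abs_padic (rep_padic :: 'p padic \<Rightarrow> _) cr_padic"
  unfolding abs_padic_def rep_padic_def
  by (rule Quotient3_to_Quotient[OF quot_type.Quotient[OF quot_type_padic]])
     (simp add: cr_padic_def abs_padic_def)

setup_lifting Quotient_padic

instantiation padic :: (prime_card) field
begin

lift_definition zero_padic :: "'a padic" is "\<lambda>n. 0"
  by (simp add: padicrel_refl)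

lift_definition one_padic :: "'a padic" is "\<lambda>n. 1"
  by (simp add: padicrel_refl)

lift_definition plus_padic :: "'a padic \<Rightarrow> 'a padic \<Rightarrow> 'a padic" is "\<lambda>X Y n. X n + Y n"
  unfolding padicrel_def add_diff_add
  by (simp add: padic_cauchy_add[OF prime_card] padic_null_add[OF prime_card])

lift_definition uminus_padic :: "'a padic \<Rightarrow> 'a padic" is "\<lambda>X n. - X n"
  unfolding padicrel_def minus_diff_minus
  by (simp only: padic_cauchy_minus[OF prime_card] padic_null_minus[OF prime_card] simp_thms)

lift_definition times_padic :: "'a padic \<Rightarrow> 'a padic \<Rightarrow> 'a padic" is "\<lambda>X Y n. X n * Y n"
proof -
  fix f1 f2 f3 f4 :: "nat \<Rightarrow> rat"
  assume "padicrel TYPE('a) f1 f2" "padicrel TYPE('a) f3 f4"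
  then have f: "padic_cauchy CARD('a) f1" "padic_cauchy CARD('a) f2"
      "padic_cauchy CARD('a) f3" "padic_cauchy CARD('a) f4"
      "padic_null CARD('a) (\<lambda>n. f1 n - f2 n)" "padic_null CARD('a) (\<lambda>n. f3 n - f4 n)"
    by (simp_all add: padicrel_def)
  have "padic_null CARD('a) (\<lambda>n. f1 n * (f3 n - f4 n) + f4 n * (f1 n - f2 n))"
    by (intro padic_null_add[OF prime_card] padic_null_mult_bounded[OF prime_card] f)
  moreover have "f1 n * (f3 n - f4 n) + f4 n * (f1 n - f2 n) = f1 n * f3 n - f2 n * f4 n" for n
    by (simp add: algebra_simps)
  ultimately show "padicrel TYPE('a) (\<lambda>n. f1 n * f3 n) (\<lambda>n. f2 n * f4 n)"
    using f by (simp add: padicrel_def padic_cauchy_mult[OF prime_card])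
qed

lift_definition inverse_padic :: "'a padic \<Rightarrow> 'a padic"
  is "\<lambda>X. if padic_null CARD('a) X then (\<lambda>n. 0) else (\<lambda>n. inverse (X n))"
proof -
  fix X Y assume "padicrel TYPE('a) X Y"
  then have X: "padic_cauchy CARD('a) X" and Y: "padic_cauchy CARD('a) Y"
    and XY: "padic_null CARD('a) (\<lambda>n. X n - Y n)"
    by (simp_all add: padicrel_def)
  have "padic_null CARD('a) X \<longleftrightarrow> padic_null CARD('a) Y"
    using padic_null_add[OF prime_card XY, of Y]
      padic_null_add[OF prime_card padic_null_minus[OF prime_card XY], of X] by auto
  then show "?thesis X Y"
    using padic_cauchy_inverse[OF prime_card X] padic_cauchy_inverse[OF prime_card Y]
      padic_null_diff_inverse[OF prime_card X _ Y _ XY]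
    by (simp add: padicrel_def)
qed

definition "x - y = x + - y" for x y :: "'a padic"

definition "x div y = x * inverse y" for x y :: "'a padic"

instance
proof
  fix a b c :: "'a padic"
  show "a + b = b + a"
    by transfer (simp add: add.commute padicrel_def padic_cauchy_add[OF prime_card])
  show "(a + b) + c = a + (b + c)"
    by transfer (simp add: add.assoc padicrel_def padic_cauchy_add[OF prime_card])
  show "0 + a = a"
    by transfer (simp add: padicrel_def)
  show "- a + a = 0"
    by transfer (simp add: padicrel_def)
  show "a - b = a + - b"
    by (rule minus_padic_def)
  show "(a * b) * c = a * (b * c)"
    by transfer (simp add: mult.assoc padicrel_def padic_cauchy_mult[OF prime_card])
  show "a * b = b * a"
    by transfer (simp add: mult.commute padicrel_def padic_cauchy_mult[OF prime_card])
  show "1 * a = a"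
    by transfer (simp add: padicrel_def)
  show "(a + b) * c = a * c + b * c"
    by transfer (simp add: distrib_right padicrel_def padic_cauchy_mult[OF prime_card]
        padic_cauchy_add[OF prime_card])
  show "(0::'a padic) \<noteq> 1"
    by transfer (simp add: padicrel_def padic_null_def padic_abs_minus[OF prime_card]
        padic_abs_1[OF prime_card] LIMSEQ_const_iff)
  have "padic_null CARD('a) (\<lambda>n. inverse (X n) * X n - 1)"
    if X: "padic_cauchy CARD('a) X" "\<not> padic_null CARD('a) X" for X
  proof -
    obtain b k where "b > 0" "\<forall>n\<ge>k. b < padic_abs CARD('a) (X n)"
      using padic_cauchy_not_null[OF prime_card X] by blast
    then have nz: "X n \<noteq> 0" if "n \<ge> k" for n using that by fastforce
    show ?thesis
      by (rule padic_null_le[of _ _ "\<lambda>n. 0"])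
         (auto simp: eventually_sequentially nz intro!: exI[of _ k])
  qed
  then show "a \<noteq> 0 \<Longrightarrow> inverse a * a = 1"
    by transfer (simp add: padicrel_def padic_cauchy_mult[OF prime_card]
        padic_cauchy_inverse[OF prime_card])
  show "a div b = a * inverse b"
    by (rule divide_padic_def)
  show "inverse (0::'a padic) = 0"
    by transfer (simp add: padicrel_def)
qed

end

lift_definition padic_norm :: "'p::prime_card padic \<Rightarrow> real"
  is "\<lambda>X. lim (\<lambda>n. padic_abs CARD('p) (X n))"
proof -
  fix X Y assume "padicrel TYPE('p) X Y"
  then have X: "padic_cauchy CARD('p) X" and Y: "padic_cauchy CARD('p) Y"
    and XY: "padic_null CARD('p) (\<lambda>n. X n - Y n)"
    by (simp_all add: padicrel_def)
  have "(\<lambda>n. padic_abs CARD('p) (X n) - padic_abs CARD('p) (Y n)) \<longlonglongrightarrow> 0"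
    by (rule Lim_null_comparison[OF _ XY[unfolded padic_null_def]])
       (simp add: padic_abs_diff_abs[OF prime_card])
  from tendsto_diff[OF padic_cauchy_abs_tendsto[OF prime_card X] this]
  have "(\<lambda>n. padic_abs CARD('p) (Y n)) \<longlonglongrightarrow> lim (\<lambda>n. padic_abs CARD('p) (X n))"
    by simp
  then show "lim (\<lambda>n. padic_abs CARD('p) (X n)) = lim (\<lambda>n. padic_abs CARD('p) (Y n))"
    by (simp add: limI)
qed

lemma of_nat_padic: "(of_nat n :: 'p::prime_card padic) = abs_padic (\<lambda>_. of_nat n)"
proof (induction n)
  case 0
  show ?case by (simp add: zero_padic.abs_eq)
next
  case (Suc n)
  then show ?case by (simp add: one_padic.abs_eq plus_padic.abs_eq padicrel_refl)
qed

lemma padic_norm_of_nat: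
  "padic_norm (of_nat n :: 'p::prime_card padic) = padic_abs CARD('p) (of_nat n)"
  by (simp add: of_nat_padic padic_norm.abs_eq padicrel_refl)

lemma padic_norm_p: "padic_norm (of_nat CARD('p) :: 'p::prime_card padic) = 1 / real CARD('p)"
  using padic_abs_fract[OF prime_card[where 'a = 'p], of "int CARD('p)" 1]
    prime_gt_0_nat[OF prime_card[where 'a = 'p]]
  by (simp add: padic_norm_of_nat prime_card power_int_minus divide_inverse multiplicity_prime)

definition Ep :: "'p::prime_card padic set" where
  "Ep = {x. padic_norm x = 1 \<and>
            padic_norm (x - 1) < real CARD('p) powr (- 1 / (real CARD('p) - 1))}"


section \<open>The Potts model on the Cayley tree of order three\<close>

subsection \<open>Tree and configurations\<close>

text \<open>
  A vertex is a list over a three-element type; the root is \<open>[]\<close>, and the direct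
  successors of \<open>x\<close> are \<open>i # x\<close>. The distance to the root is the length of the list.
\<close>

type_synonym vertex = "3 list"

definition tree_W :: "nat \<Rightarrow> vertex set" where
  "tree_W n = {x. length x = n}"

definition tree_V :: "nat \<Rightarrow> vertex set" where
  "tree_V n = (\<Union>m\<le>n. tree_W m)"

text \<open>Every edge is listed once, as the pair of a vertex and its direct successor.\<close>

definition tree_L :: "nat \<Rightarrow> (vertex \<times> vertex) set" where
  "tree_L n = {(x, y). x \<in> tree_V n \<and> y \<in> tree_V n \<and> (\<exists>i. y = i # x)}"

definition \<Omega> :: "nat \<Rightarrow> (vertex \<Rightarrow> nat) set" where
  "\<Omega> q = (UNIV \<rightarrow>\<^sub>E {..<q})"

definition \<Omega>_on :: "nat \<Rightarrow> vertex set \<Rightarrow> (vertex \<Rightarrow> nat) set" where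
  "\<Omega>_on q A = (A \<rightarrow>\<^sub>E {..<q})"

definition hamiltonian :: "nat \<Rightarrow> (vertex \<Rightarrow> nat) \<Rightarrow> nat" where
  "hamiltonian n \<sigma> = (\<Sum>(x, y)\<in>tree_L n. if \<sigma> x = \<sigma> y then 1 else 0)"


subsection \<open>Finite-volume distributions\<close>

text \<open>
  A boundary function is a map \<open>h\<close> with \<open>h x i\<close> standing for \<open>h\<^sub>i\<^sub>,\<^sub>x\<close>. Its values at the
  root \<open>[]\<close> and at spins \<open>i \<ge> q\<close> are never used.
\<close>

definition boltzmann_weight ::
  "'p::prime_card padic \<Rightarrow> (vertex \<Rightarrow> nat \<Rightarrow> 'p padic) \<Rightarrow> nat \<Rightarrow> (vertex \<Rightarrow> nat) \<Rightarrow> 'p padic" where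
  "boltzmann_weight \<rho> h n \<sigma> = \<rho> ^ hamiltonian n \<sigma> * (\<Prod>x\<in>tree_W n. h x (\<sigma> x))"

definition partition_function ::
  "nat \<Rightarrow> 'p::prime_card padic \<Rightarrow> (vertex \<Rightarrow> nat \<Rightarrow> 'p padic) \<Rightarrow> nat \<Rightarrow> 'p padic" where
  "partition_function q \<rho> h n = (\<Sum>\<sigma>\<in>\<Omega>_on q (tree_V n). boltzmann_weight \<rho> h n \<sigma>)"

definition mu_fin ::
  "nat \<Rightarrow> 'p::prime_card padic \<Rightarrow> (vertex \<Rightarrow> nat \<Rightarrow> 'p padic) \<Rightarrow> nat \<Rightarrow> (vertex \<Rightarrow> nat) \<Rightarrow> 'p padic" where
  "mu_fin q \<rho> h n \<sigma> = boltzmann_weight \<rho> h n \<sigma> / partition_function q \<rho> h n"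

definition compatible ::
  "nat \<Rightarrow> 'p::prime_card padic \<Rightarrow> (vertex \<Rightarrow> nat \<Rightarrow> 'p padic) \<Rightarrow> bool" where
  "compatible q \<rho> h \<longleftrightarrow>
     (\<forall>n\<ge>2. \<forall>\<sigma>\<in>\<Omega>_on q (tree_V (n - 1)).
        (\<Sum>\<omega>\<in>\<Omega>_on q (tree_W n). mu_fin q \<rho> h n (override_on \<sigma> \<omega> (tree_W n))) = mu_fin q \<rho> h (n - 1) \<sigma>)"


subsection \<open>p-adic measures\<close>

definition cylinder_sets :: "nat \<Rightarrow> (vertex \<Rightarrow> nat) set set" where
  "cylinder_sets q =
     {{\<sigma> \<in> \<Omega> q. restrict \<sigma> (tree_V n) \<in> S} |n S. S \<subseteq> \<Omega>_on q (tree_V n)}"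

text \<open>
  Measures on an algebra \<open>\<B>\<close> are taken in \<open>extensional \<B>\<close>, so that two of them are equal iff
  they agree on \<open>\<B>\<close>.
\<close>

definition padic_prob_measure ::
  "'a set \<Rightarrow> 'a set set \<Rightarrow> ('a set \<Rightarrow> 'p::prime_card padic) \<Rightarrow> bool" where
  "padic_prob_measure X \<B> \<mu> \<longleftrightarrow>
     \<mu> \<in> extensional \<B> \<and> Measure_Space.additive \<B> \<mu> \<and> \<mu> X = 1"

definition bounded_measure :: "'a set set \<Rightarrow> ('a set \<Rightarrow> 'p::prime_card padic) \<Rightarrow> bool" where
  "bounded_measure \<B> \<mu> \<longleftrightarrow> bdd_above ((\<lambda>A. padic_norm (\<mu> A)) ` \<B>)"


subsection \<open>Generalized p-adic quasi Gibbs measures\<close>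

text \<open>
  The condition on the partition functions says that the finite-volume distributions are defined;
  it matters because division by zero yields zero in HOL.
\<close>

definition quasi_gibbs_measure ::
  "nat \<Rightarrow> 'p::prime_card padic \<Rightarrow> (vertex \<Rightarrow> nat \<Rightarrow> 'p padic)
     \<Rightarrow> ((vertex \<Rightarrow> nat) set \<Rightarrow> 'p padic) \<Rightarrow> bool" where
  "quasi_gibbs_measure q \<rho> h \<mu> \<longleftrightarrow>
     (\<forall>x. x \<noteq> [] \<longrightarrow> h x 0 = 1) \<and>
     (\<forall>n\<ge>1. partition_function q \<rho> h n \<noteq> 0) \<and>
     compatible q \<rho> h \<and>
     padic_prob_measure (\<Omega> q) (cylinder_sets q) \<mu> \<and>
     (\<forall>n\<ge>1. \<forall>\<tau>\<in>\<Omega>_on q (tree_V n). \<mu> {\<sigma> \<in> \<Omega> q. restrict \<sigma> (tree_V n) = \<tau>} = mu_fin q \<rho> h n \<tau>)"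

definition generalized_quasi_gibbs ::
  "nat \<Rightarrow> 'p::prime_card padic \<Rightarrow> ((vertex \<Rightarrow> nat) set \<Rightarrow> 'p padic) \<Rightarrow> bool" where
  "generalized_quasi_gibbs q \<rho> \<mu> \<longleftrightarrow> (\<exists>h. quasi_gibbs_measure q \<rho> h \<mu>)"

definition gibbs_measure ::
  "nat \<Rightarrow> 'p::prime_card padic \<Rightarrow> (vertex \<Rightarrow> nat \<Rightarrow> 'p padic)
     \<Rightarrow> ((vertex \<Rightarrow> nat) set \<Rightarrow> 'p padic) \<Rightarrow> bool" where
  "gibbs_measure q \<rho> h \<mu> \<longleftrightarrow>
     quasi_gibbs_measure q \<rho> h \<mu> \<and> \<rho> \<in> Ep \<and> (\<forall>x. x \<noteq> [] \<longrightarrow> (\<forall>i<q. h x i \<in> Ep))"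

definition translation_invariant :: "nat \<Rightarrow> (vertex \<Rightarrow> nat \<Rightarrow> 'a) \<Rightarrow> bool" where
  "translation_invariant q h \<longleftrightarrow> (\<exists>c. \<forall>x. x \<noteq> [] \<longrightarrow> (\<forall>i<q. h x i = c i))"

definition ti_gibbs_measure ::
  "nat \<Rightarrow> 'p::prime_card padic \<Rightarrow> (vertex \<Rightarrow> nat \<Rightarrow> 'p padic)
     \<Rightarrow> ((vertex \<Rightarrow> nat) set \<Rightarrow> 'p padic) \<Rightarrow> bool" where
  "ti_gibbs_measure q \<rho> h \<mu> \<longleftrightarrow> gibbs_measure q \<rho> h \<mu> \<and> translation_invariant q h"

definition phase_transition :: "nat \<Rightarrow> 'p::prime_card padic \<Rightarrow> bool" where
  "phase_transition q \<rho> \<longleftrightarrow>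
     (\<exists>\<mu> \<nu>. generalized_quasi_gibbs q \<rho> \<mu> \<and> generalized_quasi_gibbs q \<rho> \<nu> \<and> \<mu> \<noteq> \<nu> \<and>
        (\<not> bounded_measure (cylinder_sets q) \<mu> \<or> \<not> bounded_measure (cylinder_sets q) \<nu>))"


subsection \<open>The invariant line\<close>

definition line_field :: "nat \<Rightarrow> 'a::one \<Rightarrow> vertex \<Rightarrow> nat \<Rightarrow> 'a" where
  "line_field i0 h x i = (if i = i0 then h else 1)"

text \<open>The nonvanishing of the denominator is part of being a solution, as division by zero is total in HOL.\<close>

definition fixed_point_solution :: "nat \<Rightarrow> 'a::field \<Rightarrow> 'a \<Rightarrow> bool" where
  "fixed_point_solution q \<rho> h \<longleftrightarrow>
     h + \<rho> + of_nat q - 2 \<noteq> 0 \<and>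
     h = ((\<rho> * h + of_nat q - 1) / (h + \<rho> + of_nat q - 2)) ^ 3"

definition coeff_A :: "nat \<Rightarrow> 'a::field \<Rightarrow> 'a" where
  "coeff_A q \<rho> = \<rho> ^ 3 - 3 * \<rho> - 3 * of_nat q + 5"

definition coeff_B :: "nat \<Rightarrow> 'a::field \<Rightarrow> 'a" where
  "coeff_B q \<rho> = \<rho> * (\<rho> - 3)\<^sup>2 + 9 * of_nat q + 3 * \<rho> * of_nat q * (\<rho> - 2) - 3 * (of_nat q)\<^sup>2 - 7"

definition coeff_C :: "nat \<Rightarrow> 'a::field" where
  "coeff_C q = (of_nat q - 1) ^ 3"

definition cubic_root :: "nat \<Rightarrow> 'a::field \<Rightarrow> 'a \<Rightarrow> bool" where
  "cubic_root q \<rho> x \<longleftrightarrow> x ^ 3 - coeff_A q \<rho> * x\<^sup>2 - coeff_B q \<rho> * x + coeff_C q = 0"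

end

theory Submission
  imports Defs
begin

text \<open>
  Suppose that summing out the spins of the three children of any vertex other than the root
  reproduces the boundary function up to a constant factor \<open>a \<noteq> 0\<close>. Then the finite-volume
  distributions are compatible and \<open>Z\<^sub>n\<^sub>+\<^sub>1 = a\<^bsup>3^n\<^esup> Z\<^sub>n\<close>. If \<open>a\<close> has norm less than 1, then
  \<open>Z\<^sub>n\<close> tends to zero while the weight of the zero configuration has norm 1, so the measure is
  unbounded. On the invariant line \<open>a\<close> is the cube of \<open>x + \<rho> + q - 2 = (x - 1) + (\<rho> - 1) + q\<close>,
  whose summands all have norm less than 1.

  A phase transition for \<open>\<rho> \<noteq> 1\<close> does not need the roots of the cubic: boundary functions with
  coordinate sum zero satisfy the recursion with \<open>a = (\<rho> - 1)\<^sup>3\<close> as soon as their coordinates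
  equal their cubes, and two of them that differ on the subtrees at the root give distinct
  unbounded measures. This covers \<open>\<rho> = 1 - q\<close>, where \<open>x = 1\<close> is not a solution.
\<close>

subsection \<open>The p-adic norm\<close>

text \<open>The \<open>lim\<close> in the definition of the norm is a genuine limit on Cauchy
  sequences. The laws of \<open>padic_abs\<close> therefore pass to the completion by taking limits
  along representatives.\<close>

lemma padic_norm_tendsto:
  assumes "padic_cauchy CARD('p::prime_card) X"
  shows "(\<lambda>n. padic_abs CARD('p) (X n)) \<longlonglongrightarrow> padic_norm (abs_padic X :: 'p padic)"
  using padic_cauchy_abs_tendsto[OF prime_card assms]
  by (simp add: padic_norm.abs_eq padicrel_refl assms)

lemma padic_cases:
  obtains X where "padic_cauchy CARD('p::prime_card) X" "x = (abs_padic X :: 'p padic)"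
  using Quotient_rep_reflp[OF Quotient_padic] Quotient_abs_rep[OF Quotient_padic]
  by (metis padicrel_def)

lemma padic_norm_nonneg [simp]: "padic_norm x \<ge> 0"
proof (cases x rule: padic_cases)
  case (1 X)
  then show ?thesis
    by (auto intro: LIMSEQ_le_const[OF padic_norm_tendsto])
qed

lemma padic_norm_0 [simp]: "padic_norm 0 = 0"
  by transfer simp

lemma padic_norm_1 [simp]: "padic_norm (1 :: 'p::prime_card padic) = 1"
  by transfer (simp add: padic_abs_1[OF prime_card])

lemma padic_norm_mult: "padic_norm (x * y) = padic_norm x * padic_norm y"
proof (cases x rule: padic_cases)
  case X: (1 X)
  show ?thesis
  proof (cases y rule: padic_cases)
    case Y: (1 Y)
    have "x * y = abs_padic (\<lambda>n. X n * Y n)"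
      using X Y by (simp add: times_padic.abs_eq padicrel_refl)
    then have "(\<lambda>n. padic_abs CARD('a) (X n * Y n)) \<longlonglongrightarrow> padic_norm (x * y)"
      using padic_norm_tendsto[OF padic_cauchy_mult[OF prime_card X(1) Y(1)]] by simp
    moreover have "(\<lambda>n. padic_abs CARD('a) (X n * Y n)) \<longlonglongrightarrow> padic_norm x * padic_norm y"
      unfolding padic_abs_mult[OF prime_card] X(2) Y(2)
      by (intro tendsto_mult padic_norm_tendsto X(1) Y(1))
    ultimately show ?thesis by (rule LIMSEQ_unique)
  qed
qed

lemma padic_norm_add: "padic_norm (x + y) \<le> max (padic_norm x) (padic_norm y)"
proof (cases x rule: padic_cases)
  case X: (1 X)
  show ?thesis
  proof (cases y rule: padic_cases)
    case Y: (1 Y)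
    have "x + y = abs_padic (\<lambda>n. X n + Y n)"
      using X Y by (simp add: plus_padic.abs_eq padicrel_refl)
    then have "(\<lambda>n. padic_abs CARD('a) (X n + Y n)) \<longlonglongrightarrow> padic_norm (x + y)"
      using padic_norm_tendsto[OF padic_cauchy_add[OF prime_card X(1) Y(1)]] by simp
    moreover have "(\<lambda>n. max (padic_abs CARD('a) (X n)) (padic_abs CARD('a) (Y n)))
        \<longlonglongrightarrow> max (padic_norm x) (padic_norm y)"
      unfolding X(2) Y(2) by (intro tendsto_max padic_norm_tendsto X(1) Y(1))
    ultimately show ?thesis
      by (rule LIMSEQ_le) (use padic_abs_add[OF prime_card] in auto)
  qed
qed

text \<open>For nonzero \<open>x\<close>, multiplicativity applied to
  \<open>x * inverse x = 1\<close> excludes norm 0.\<close>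

lemma padic_norm_eq_0_iff [simp]: "padic_norm x = 0 \<longleftrightarrow> x = 0"
proof
  assume "padic_norm x = 0"
  then show "x = 0"
    using padic_norm_mult[of x "inverse x"] by (cases "x = 0") auto
qed simp

lemma padic_norm_power: "padic_norm (x ^ n) = padic_norm x ^ n"
  by (induction n) (simp_all add: padic_norm_mult)

lemma padic_norm_divide: "padic_norm (x / y) = padic_norm x / padic_norm y"
proof (cases "y = 0")
  case False
  then show ?thesis
    using padic_norm_mult[of "x / y" y] by (simp add: field_simps)
qed simp

section \<open>Characteristic zero\<close>

lemma padic_of_nat_eq_0_iff [simp]: "(of_nat n :: 'p::prime_card padic) = 0 \<longleftrightarrow> n = 0"
  using padic_abs_eq_0_iff[OF prime_card[where 'a = 'p], of "of_nat n"]
  by (simp flip: padic_norm_of_nat)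

lemma padic_of_nat_eq_iff [simp]:
  "(of_nat m :: 'p::prime_card padic) = of_nat n \<longleftrightarrow> m = n"
proof -
  have "m = n" if "(of_nat m :: 'p padic) = of_nat n" "m \<le> n" for m n
    using that padic_of_nat_eq_0_iff[of "n - m", where 'p = 'p] by (simp add: of_nat_diff)
  then show ?thesis by (metis nle_le)
qed

section \<open>Elements of \<open>Ep\<close>\<close>

lemma Ep_1 [simp]: "1 \<in> Ep"
  using prime_gt_0_nat[OF prime_card] by (simp add: Ep_def)

lemma Ep_norm: "x \<in> Ep \<Longrightarrow> padic_norm x = 1"
  by (simp add: Ep_def)

text \<open>The radius in the definition of \<open>Ep\<close> is a negative power of the prime,
  hence at most 1.\<close>

lemma Ep_norm_diff_1:
  assumes "x \<in> (Ep :: 'p::prime_card padic set)"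
  shows "padic_norm (x - 1) < 1"
proof -
  have "real CARD('p) powr (- 1 / (real CARD('p) - 1)) \<le> 1"
    using prime_gt_1_nat[OF prime_card[where 'a = 'p]]
      powr_mono[of "- 1 / (real CARD('p) - 1)" 0 "real CARD('p)"]
    by simp
  then show ?thesis using assms by (simp add: Ep_def)
qed


subsection \<open>Configurations on the tree\<close>

lemma tree_V_0: "tree_V 0 = {[]}"
  by (auto simp: tree_V_def tree_W_def)

lemma tree_V_Suc: "tree_V (Suc n) = tree_V n \<union> tree_W (Suc n)"
  by (auto simp: tree_V_def le_Suc_eq)

lemma tree_V_mono: "m \<le> n \<Longrightarrow> tree_V m \<subseteq> tree_V n"
  by (force simp: tree_V_def)

lemma tree_V_disjoint_tree_W: "tree_V n \<inter> tree_W (Suc n) = {}"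
  by (auto simp: tree_V_def tree_W_def)

lemma tree_W_Suc: "tree_W (Suc n) = (\<lambda>(x, c). c # x) ` (tree_W n \<times> UNIV)"
  by (force simp: tree_W_def length_Suc_conv image_iff)

lemma finite_tree_W [simp]: "finite (tree_W n)"
  using finite_lists_length_eq[of "UNIV :: 3 set" n] by (simp add: tree_W_def)

lemma card_tree_W: "card (tree_W n) = 3 ^ n"
  using card_lists_length_eq[of "UNIV :: 3 set" n] by (simp add: tree_W_def)

lemma finite_tree_V [simp]: "finite (tree_V n)"
  by (simp add: tree_V_def)

lemma tree_L_Suc: "tree_L (Suc n) = tree_L n \<union> (\<lambda>(x, c). (x, c # x)) ` (tree_W n \<times> UNIV)"
  by (auto simp: tree_L_def tree_V_def tree_W_def image_iff)

lemma finite_tree_L [simp]: "finite (tree_L n)"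
  by (rule finite_subset[of _ "tree_V n \<times> tree_V n"]) (auto simp: tree_L_def)

lemma hamiltonian_Suc:
  "hamiltonian (Suc n) \<sigma>
     = hamiltonian n \<sigma> + (\<Sum>x\<in>tree_W n. \<Sum>c\<in>UNIV. if \<sigma> x = \<sigma> (c # x) then 1 else 0)"
proof -
  have "tree_L n \<inter> (\<lambda>(x, c). (x, c # x)) ` (tree_W n \<times> UNIV) = {}"
    by (auto simp: tree_L_def tree_V_def tree_W_def)
  moreover have "inj_on (\<lambda>(x, c). (x, c # x)) (tree_W n \<times> UNIV)"
    by (auto simp: inj_on_def)
  ultimately show ?thesis
    unfolding hamiltonian_def tree_L_Suc
    by (subst sum.union_disjoint)
       (auto simp: sum.reindex sum.cartesian_product case_prod_unfold)
qed

lemma hamiltonian_cong: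
  assumes "\<And>x. x \<in> tree_V n \<Longrightarrow> \<sigma> x = \<tau> x"
  shows "hamiltonian n \<sigma> = hamiltonian n \<tau>"
  unfolding hamiltonian_def
  by (rule sum.cong) (auto simp: tree_L_def assms)

section \<open>Configurations, their restrictions and extensions\<close>

lemma finite_\<Omega>_on [simp]: "finite A \<Longrightarrow> finite (\<Omega>_on q A)"
  by (auto simp: \<Omega>_on_def intro: finite_PiE)

lemma restrict_in_\<Omega>_on: "\<sigma> \<in> \<Omega> q \<Longrightarrow> restrict \<sigma> A \<in> \<Omega>_on q A"
  by (auto simp: \<Omega>_def \<Omega>_on_def)

lemma restrict_restrict_tree_V:
  "m \<le> n \<Longrightarrow> restrict (restrict \<sigma> (tree_V n)) (tree_V m) = restrict \<sigma> (tree_V m)"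
  using tree_V_mono[of m n] by (auto simp: restrict_def fun_eq_iff)

lemma \<Omega>_on_extend:
  assumes "\<tau> \<in> \<Omega>_on q A" "q > 0"
  obtains \<sigma> where "\<sigma> \<in> \<Omega> q" "restrict \<sigma> A = \<tau>"
proof
  show "(\<lambda>x. if x \<in> A then \<tau> x else 0) \<in> \<Omega> q"
    using assms by (auto simp: \<Omega>_def \<Omega>_on_def)
  show "restrict (\<lambda>x. if x \<in> A then \<tau> x else 0) A = \<tau>"
    using assms by (auto simp: \<Omega>_on_def fun_eq_iff PiE_def extensional_def)
qed

text \<open>A configuration on a disjoint union is a pair of configurations. The set
  \<open>S\<close> allows summing over the fibres above an arbitrary family of inner configurations,
  as needed for cylinders.\<close>

lemma sum_override:
  assumes "S \<subseteq> \<Omega>_on q A" "A \<inter> B = {}"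
  shows "(\<Sum>\<tau> | \<tau> \<in> \<Omega>_on q (A \<union> B) \<and> restrict \<tau> A \<in> S. f \<tau>)
           = (\<Sum>\<sigma>\<in>S. \<Sum>\<omega>\<in>\<Omega>_on q B. f (override_on \<sigma> \<omega> B))"
proof -
  have "restrict (override_on \<sigma> \<omega> B) A = \<sigma>"
    if "\<sigma> \<in> S" for \<sigma> \<omega>
    using that assms
    by (fastforce simp: \<Omega>_on_def fun_eq_iff override_on_def restrict_def PiE_def extensional_def)
  moreover have "restrict (override_on \<sigma> \<omega> B) B = \<omega>"
    if "\<omega> \<in> \<Omega>_on q B" for \<sigma> \<omega>
    using that
    by (fastforce simp: \<Omega>_on_def fun_eq_iff override_on_def restrict_def PiE_def extensional_def)
  moreover have "override_on (restrict \<tau> A) (restrict \<tau> B) B = \<tau>"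
    if "\<tau> \<in> \<Omega>_on q (A \<union> B)" for \<tau>
    using that
    by (fastforce simp: \<Omega>_on_def fun_eq_iff override_on_def restrict_def PiE_def extensional_def)
  moreover have "override_on \<sigma> \<omega> B \<in> \<Omega>_on q (A \<union> B)"
    if "\<sigma> \<in> S" "\<omega> \<in> \<Omega>_on q B" for \<sigma> \<omega>
    using that assms
    by (fastforce simp: \<Omega>_on_def fun_eq_iff override_on_def PiE_def extensional_def Pi_def)
  moreover have "restrict \<tau> B \<in> \<Omega>_on q B" if "\<tau> \<in> \<Omega>_on q (A \<union> B)" for \<tau>
    using that by (auto simp: \<Omega>_on_def)
  ultimately show ?thesis
    unfolding sum.cartesian_product
    by (intro sum.reindex_bij_witness[of _ "\<lambda>(\<sigma>, \<omega>). override_on \<sigma> \<omega> B"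
          "\<lambda>\<tau>. (restrict \<tau> A, restrict \<tau> B)"]) auto
qed

lemma sum_\<Omega>_on_tree_V_Suc:
  "(\<Sum>\<tau>\<in>\<Omega>_on q (tree_V (Suc n)). f \<tau>)
     = (\<Sum>\<sigma>\<in>\<Omega>_on q (tree_V n). \<Sum>\<omega>\<in>\<Omega>_on q (tree_W (Suc n)). f (override_on \<sigma> \<omega> (tree_W (Suc n))))"
proof -
  have "{\<tau> \<in> \<Omega>_on q (tree_V n \<union> tree_W (Suc n)). restrict \<tau> (tree_V n) \<in> \<Omega>_on q (tree_V n)}
      = \<Omega>_on q (tree_V (Suc n))"
    by (auto simp: \<Omega>_on_def tree_V_Suc)
  with sum_override[of "\<Omega>_on q (tree_V n)" q "tree_V n" "tree_W (Suc n)" f]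
    tree_V_disjoint_tree_W[of n] show ?thesis
    by (simp add: tree_V_Suc)
qed


subsection \<open>Summing out the outermost sphere\<close>

text \<open>The factor that a child with boundary vector \<open>g\<close> contributes to a parent of
  spin \<open>i\<close> once the spin of the child is summed out: the Potts transfer matrix applied
  to \<open>g\<close>.\<close>

definition child_sum ::
  "nat \<Rightarrow> 'p::prime_card padic \<Rightarrow> (nat \<Rightarrow> 'p padic) \<Rightarrow> nat \<Rightarrow> 'p padic" where
  "child_sum q \<rho> g i = (\<Sum>j<q. (if i = j then \<rho> else 1) * g j)"

text \<open>The transfer matrix is (\<rho> - 1) times the identity plus the all-ones matrix, so
  vectors of coordinate sum zero are eigenvectors.\<close>

lemma child_sum_eq:
  assumes "i < q"
  shows "child_sum q \<rho> g i = (\<rho> - 1) * g i + (\<Sum>j<q. g j)"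
proof -
  have "child_sum q \<rho> g i = (\<Sum>j<q. (if i = j then (\<rho> - 1) * g j else 0) + g j)"
    unfolding child_sum_def by (intro sum.cong) (auto simp: algebra_simps)
  also have "\<dots> = (\<rho> - 1) * g i + (\<Sum>j<q. g j)"
    using assms by (simp add: sum.distrib sum.delta')
  finally show ?thesis .
qed

text \<open>Each vertex \<open>y\<close> of the new sphere lies on exactly one new edge, the one to
  its parent \<open>tl y\<close>, so the new interactions form a product over the sphere.\<close>

lemma boltzmann_weight_Suc:
  "boltzmann_weight \<rho> h (Suc n) \<sigma>
     = \<rho> ^ hamiltonian n \<sigma> *
       (\<Prod>y\<in>tree_W (Suc n). (if \<sigma> (tl y) = \<sigma> y then \<rho> else 1) * h y (\<sigma> y))"
proof -
  have "inj_on (\<lambda>(x, c). c # x) (tree_W n \<times> (UNIV :: 3 set))"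
    by (auto simp: inj_on_def)
  then have "(\<Prod>y\<in>tree_W (Suc n). if \<sigma> (tl y) = \<sigma> y then \<rho> else 1)
      = (\<Prod>x\<in>tree_W n. \<Prod>c\<in>UNIV. \<rho> ^ (if \<sigma> x = \<sigma> (c # x) then 1 else 0))"
    unfolding tree_W_Suc
    by (auto simp: prod.reindex prod.cartesian_product case_prod_unfold intro!: prod.cong)
  then show ?thesis
    by (simp add: boltzmann_weight_def hamiltonian_Suc power_add power_sum prod.distrib mult.assoc)
qed

text \<open>With the inner spins fixed, the spins on the outer sphere do not interact with each
  other, so the sum over them factorizes over the vertices of the sphere.\<close>

lemma sum_boltzmann_weight_override:
  "(\<Sum>\<omega>\<in>\<Omega>_on q (tree_W (Suc n)). boltzmann_weight \<rho> h (Suc n) (override_on \<sigma> \<omega> (tree_W (Suc n))))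
     = \<rho> ^ hamiltonian n \<sigma> * (\<Prod>x\<in>tree_W n. \<Prod>c\<in>UNIV. child_sum q \<rho> (h (c # x)) (\<sigma> x))"
proof -
  let ?W = "tree_W (Suc n)"
  let ?g = "\<lambda>y j. (if \<sigma> (tl y) = j then \<rho> else 1) * h y j"
  \<comment> \<open>Parents lie one sphere lower and keep the spin given by \<sigma>.\<close>
  have tl: "tl y \<notin> ?W" if "y \<in> ?W" for y
    using that by (auto simp: tree_W_def)
  have "hamiltonian n (override_on \<sigma> \<omega> ?W) = hamiltonian n \<sigma>" for \<omega>
    using tree_V_disjoint_tree_W[of n] by (intro hamiltonian_cong) (auto simp: override_on_def)
  then have "boltzmann_weight \<rho> h (Suc n) (override_on \<sigma> \<omega> ?W)
      = \<rho> ^ hamiltonian n \<sigma> * (\<Prod>y\<in>?W. ?g y (\<omega> y))" for \<omega>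
    unfolding boltzmann_weight_Suc by (auto simp: tl override_on_def intro!: prod.cong)
  then have "(\<Sum>\<omega>\<in>\<Omega>_on q ?W. boltzmann_weight \<rho> h (Suc n) (override_on \<sigma> \<omega> ?W))
      = \<rho> ^ hamiltonian n \<sigma> * (\<Sum>\<omega>\<in>?W \<rightarrow>\<^sub>E {..<q}. \<Prod>y\<in>?W. ?g y (\<omega> y))"
    by (simp add: \<Omega>_on_def sum_distrib_left)
  also have "(\<Sum>\<omega>\<in>?W \<rightarrow>\<^sub>E {..<q}. \<Prod>y\<in>?W. ?g y (\<omega> y)) = (\<Prod>y\<in>?W. child_sum q \<rho> (h y) (\<sigma> (tl y)))"
    unfolding child_sum_def by (rule prod_sum_PiE[symmetric]) auto
  also have "\<dots> = (\<Prod>x\<in>tree_W n. \<Prod>c\<in>UNIV. child_sum q \<rho> (h (c # x)) (\<sigma> x))"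
  proof -
    have "inj_on (\<lambda>(x, c). c # x) (tree_W n \<times> (UNIV :: 3 set))"
      by (auto simp: inj_on_def)
    then show ?thesis
      unfolding tree_W_Suc
      by (auto simp: prod.reindex prod.cartesian_product case_prod_unfold)
  qed
  finally show ?thesis .
qed

lemma partition_function_1:
  "partition_function q \<rho> h 1 = (\<Sum>i<q. \<Prod>c\<in>UNIV. child_sum q \<rho> (h [c]) i)"
proof -
  have L0: "tree_L 0 = {}" and W0: "tree_W 0 = {[]}"
    by (auto simp: tree_L_def tree_V_0 tree_W_def)
  have "partition_function q \<rho> h 1
      = (\<Sum>\<sigma>\<in>\<Omega>_on q (tree_V 0). \<Prod>c\<in>UNIV. child_sum q \<rho> (h [c]) (\<sigma> []))"
    unfolding partition_function_def One_nat_def sum_\<Omega>_on_tree_V_Suc sum_boltzmann_weight_override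
    by (simp add: hamiltonian_def L0 W0)
  also have "\<dots> = (\<Sum>i<q. \<Prod>c\<in>UNIV. child_sum q \<rho> (h [c]) i)"
    unfolding \<Omega>_on_def tree_V_0
    by (rule sum.reindex_bij_witness[of _ "\<lambda>i. \<lambda>x\<in>{[]}. i" "\<lambda>\<sigma>. \<sigma> []"])
       (auto simp: PiE_def extensional_def fun_eq_iff)
  finally show ?thesis .
qed


subsection \<open>Extending consistent distributions to cylinder sets\<close>

text \<open>Saturation under agreement on \<open>tree_V n\<close>. In this form the level can be
  raised and unions can be taken without rewriting a base set.\<close>

definition cylinder_of_level :: "nat \<Rightarrow> nat \<Rightarrow> (vertex \<Rightarrow> nat) set \<Rightarrow> bool" where
  "cylinder_of_level q n A \<longleftrightarrow> A \<subseteq> \<Omega> q \<and>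
     (\<forall>\<sigma>\<in>A. \<forall>\<tau>\<in>\<Omega> q. restrict \<sigma> (tree_V n) = restrict \<tau> (tree_V n) \<longrightarrow> \<tau> \<in> A)"

lemma cylinder_sets_iff: "A \<in> cylinder_sets q \<longleftrightarrow> (\<exists>n. cylinder_of_level q n A)"
proof
  assume "A \<in> cylinder_sets q"
  then obtain n S where "A = {\<sigma> \<in> \<Omega> q. restrict \<sigma> (tree_V n) \<in> S}"
    by (auto simp: cylinder_sets_def)
  then show "\<exists>n. cylinder_of_level q n A"
    by (auto simp: cylinder_of_level_def intro!: exI[of _ n])
next
  assume "\<exists>n. cylinder_of_level q n A"
  then obtain n where n: "cylinder_of_level q n A" ..
  have "A = {\<sigma> \<in> \<Omega> q. restrict \<sigma> (tree_V n) \<in> (\<lambda>\<sigma>. restrict \<sigma> (tree_V n)) ` A}"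
    using n by (auto simp: cylinder_of_level_def)
  moreover have "(\<lambda>\<sigma>. restrict \<sigma> (tree_V n)) ` A \<subseteq> \<Omega>_on q (tree_V n)"
    using n by (auto simp: cylinder_of_level_def intro: restrict_in_\<Omega>_on)
  ultimately show "A \<in> cylinder_sets q"
    unfolding cylinder_sets_def by blast
qed

lemma cylinder_of_level_mono:
  assumes "cylinder_of_level q m A" "m \<le> n"
  shows "cylinder_of_level q n A"
  using assms restrict_restrict_tree_V[OF assms(2)]
  unfolding cylinder_of_level_def by metis

lemma cylinder_of_level_Un:
  "cylinder_of_level q n A \<Longrightarrow> cylinder_of_level q n B \<Longrightarrow> cylinder_of_level q n (A \<union> B)"
  unfolding cylinder_of_level_def by blast

definition level_sum ::
  "(nat \<Rightarrow> (vertex \<Rightarrow> nat) \<Rightarrow> 'p::prime_card padic) \<Rightarrow> nat \<Rightarrow> (vertex \<Rightarrow> nat) set \<Rightarrow> 'p padic" where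
  "level_sum m n A = (\<Sum>\<tau>\<in>(\<lambda>\<sigma>. restrict \<sigma> (tree_V n)) ` A. m n \<tau>)"

text \<open>The Kolmogorov consistency conditions, for finitely additive p-adic measures. They start
  at level 1, where the finite-volume distributions start.\<close>

locale consistent_family =
  fixes q :: nat and m :: "nat \<Rightarrow> (vertex \<Rightarrow> nat) \<Rightarrow> 'p::prime_card padic"
  assumes q_pos: "q > 0"
    and consistent: "\<And>n \<sigma>. n \<ge> 1 \<Longrightarrow> \<sigma> \<in> \<Omega>_on q (tree_V n) \<Longrightarrow>
       (\<Sum>\<omega>\<in>\<Omega>_on q (tree_W (Suc n)). m (Suc n) (override_on \<sigma> \<omega> (tree_W (Suc n)))) = m n \<sigma>"
    and total: "(\<Sum>\<sigma>\<in>\<Omega>_on q (tree_V 1). m 1 \<sigma>) = 1"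
begin

text \<open>The base of \<open>A\<close> at level n + 1 is the full preimage of its base at level n,
  and consistency evaluates the sum over each fibre.\<close>

lemma level_sum_Suc:
  assumes n: "n \<ge> 1" and A: "cylinder_of_level q n A"
  shows "level_sum m (Suc n) A = level_sum m n A"
proof -
  let ?R = "\<lambda>n \<sigma>. restrict \<sigma> (tree_V n)"
  have sub: "?R n ` A \<subseteq> \<Omega>_on q (tree_V n)"
    using A by (auto simp: cylinder_of_level_def intro: restrict_in_\<Omega>_on)
  have "?R (Suc n) ` A = {\<tau> \<in> \<Omega>_on q (tree_V (Suc n)). ?R n \<tau> \<in> ?R n ` A}"
  proof safe
    fix \<sigma> assume \<sigma>: "\<sigma> \<in> A"
    then show "?R (Suc n) \<sigma> \<in> \<Omega>_on q (tree_V (Suc n))"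
      using A by (auto simp: cylinder_of_level_def intro: restrict_in_\<Omega>_on)
    show "?R n (?R (Suc n) \<sigma>) \<in> ?R n ` A"
      using \<sigma> restrict_restrict_tree_V[of n "Suc n" \<sigma>] by (simp del: restrict_restrict)
  next
    fix \<tau> \<sigma> assume \<tau>: "\<tau> \<in> \<Omega>_on q (tree_V (Suc n))" and \<sigma>: "\<sigma> \<in> A" "?R n \<tau> = ?R n \<sigma>"
    \<comment> \<open>Membership in \<open>A\<close> is decided on configurations of the whole tree,
      so \<tau> is first extended to one.\<close>
    obtain \<tau>' where \<tau>': "\<tau>' \<in> \<Omega> q" "?R (Suc n) \<tau>' = \<tau>"
      using \<Omega>_on_extend[OF \<tau> q_pos] .
    have "?R n \<tau>' = ?R n \<sigma>"
      using \<tau>' \<sigma> restrict_restrict_tree_V[of n "Suc n" \<tau>'] by (simp del: restrict_restrict)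
    then have "\<tau>' \<in> A" using A \<sigma> \<tau>' unfolding cylinder_of_level_def by metis
    then show "\<tau> \<in> ?R (Suc n) ` A" using \<tau>' by blast
  qed
  then have "level_sum m (Suc n) A = (\<Sum>\<sigma>\<in>?R n ` A. \<Sum>\<omega>\<in>\<Omega>_on q (tree_W (Suc n)).
      m (Suc n) (override_on \<sigma> \<omega> (tree_W (Suc n))))"
    unfolding level_sum_def
    using sum_override[OF sub tree_V_disjoint_tree_W] by (simp add: tree_V_Suc)
  also have "\<dots> = level_sum m n A"
    unfolding level_sum_def using consistent[OF n] sub by (intro sum.cong) auto
  finally show ?thesis .
qed

lemma level_sum_eq:
  assumes "1 \<le> n" "n \<le> k" "cylinder_of_level q n A"
  shows "level_sum m k A = level_sum m n A"
  using assms(2)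
proof (induction rule: dec_induct)
  case (step k)
  then show ?case
    using level_sum_Suc[of k A] cylinder_of_level_mono[OF assms(3)] assms(1) by simp
qed simp

text \<open>The level chosen by \<open>SOME\<close> does not matter, by \<open>extension_eq\<close>.
  Restricting the function to \<open>cylinder_sets q\<close> supplies the extensionality demanded by
  \<open>padic_prob_measure\<close>.\<close>

definition extension :: "(vertex \<Rightarrow> nat) set \<Rightarrow> 'p padic" where
  "extension = (\<lambda>A\<in>cylinder_sets q. level_sum m (SOME n. n \<ge> 1 \<and> cylinder_of_level q n A) A)"

lemma extension_eq:
  assumes "n \<ge> 1" "cylinder_of_level q n A"
  shows "extension A = level_sum m n A"
proof -
  let ?k = "SOME n. n \<ge> 1 \<and> cylinder_of_level q n A"
  have k: "?k \<ge> 1 \<and> cylinder_of_level q ?k A"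
    using someI_ex[of "\<lambda>n. n \<ge> 1 \<and> cylinder_of_level q n A"] assms by blast
  \<comment> \<open>Two levels of the same set are compared at their maximum.\<close>
  have "level_sum m ?k A = level_sum m (max n ?k) A" "level_sum m n A = level_sum m (max n ?k) A"
    using k assms by (auto intro!: level_sum_eq[symmetric])
  moreover have "A \<in> cylinder_sets q"
    using assms by (auto simp: cylinder_sets_iff)
  ultimately show ?thesis by (simp add: extension_def)
qed

lemma cylinder_of_level_basic:
  "cylinder_of_level q n {\<sigma> \<in> \<Omega> q. restrict \<sigma> (tree_V n) = \<tau>}"
  by (auto simp: cylinder_of_level_def)

lemma extension_basic:
  assumes "n \<ge> 1" "\<tau> \<in> \<Omega>_on q (tree_V n)"
  shows "extension {\<sigma> \<in> \<Omega> q. restrict \<sigma> (tree_V n) = \<tau>} = m n \<tau>"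
proof -
  obtain \<sigma> where "\<sigma> \<in> \<Omega> q" "restrict \<sigma> (tree_V n) = \<tau>"
    using \<Omega>_on_extend[OF assms(2) q_pos] .
  then have "(\<lambda>\<sigma>. restrict \<sigma> (tree_V n)) ` {\<sigma> \<in> \<Omega> q. restrict \<sigma> (tree_V n) = \<tau>} = {\<tau>}"
    by auto
  then show ?thesis
    by (simp add: extension_eq[OF assms(1) cylinder_of_level_basic] level_sum_def)
qed

text \<open>Two cylinders can be brought to a common level, where disjoint cylinders have disjoint
  bases.\<close>

lemma extension_additive: "Measure_Space.additive (cylinder_sets q) extension"
  unfolding additive_def
proof (intro ballI impI)
  fix A B assume "A \<in> cylinder_sets q" "B \<in> cylinder_sets q" and disj: "A \<inter> B = {}"
  then obtain a b where "cylinder_of_level q a A" "cylinder_of_level q b B"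
    by (auto simp: cylinder_sets_iff)
  then obtain n where n: "n \<ge> 1" and A: "cylinder_of_level q n A" and B: "cylinder_of_level q n B"
    using cylinder_of_level_mono[of q a A "Suc (a + b)"] cylinder_of_level_mono[of q b B "Suc (a + b)"]
    using that[of "Suc (a + b)"] by simp
  let ?R = "\<lambda>\<sigma>. restrict \<sigma> (tree_V n)"
  have fin: "finite (?R ` C)" if "cylinder_of_level q n C" for C
    using that by (intro finite_subset[OF _ finite_\<Omega>_on[OF finite_tree_V[of n], of q]])
      (auto simp: cylinder_of_level_def intro: restrict_in_\<Omega>_on)
  have "?R ` A \<inter> ?R ` B = {}"
    using A B disj unfolding cylinder_of_level_def by (auto 0 4)
  then show "extension (A \<union> B) = extension A + extension B"
    using n A B fin
    by (simp add: extension_eq[OF n] cylinder_of_level_Un level_sum_def image_Un sum.union_disjoint)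
qed

lemma extension_prob: "padic_prob_measure (\<Omega> q) (cylinder_sets q) extension"
proof -
  have "cylinder_of_level q 1 (\<Omega> q)"
    by (simp add: cylinder_of_level_def)
  moreover have "(\<lambda>\<sigma>. restrict \<sigma> (tree_V 1)) ` \<Omega> q = \<Omega>_on q (tree_V 1)"
  proof (intro equalityI subsetI)
    fix \<tau> assume "\<tau> \<in> \<Omega>_on q (tree_V 1)"
    then obtain \<sigma> where "\<sigma> \<in> \<Omega> q" "restrict \<sigma> (tree_V 1) = \<tau>"
      using \<Omega>_on_extend[OF _ q_pos] by blast
    then show "\<tau> \<in> (\<lambda>\<sigma>. restrict \<sigma> (tree_V 1)) ` \<Omega> q" by blast
  qed (auto simp del: One_nat_def intro: restrict_in_\<Omega>_on)
  ultimately have "extension (\<Omega> q) = 1"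
    using total by (simp add: extension_eq[of 1] level_sum_def)
  moreover have "extension \<in> extensional (cylinder_sets q)"
    by (simp add: extension_def)
  ultimately show ?thesis
    by (simp add: padic_prob_measure_def extension_additive)
qed

text \<open>Every cylinder is a finite disjoint union of the basic ones, on which the measure is
  prescribed.\<close>

lemma extension_unique:
  assumes \<mu>: "padic_prob_measure (\<Omega> q) (cylinder_sets q) \<mu>"
    and basic: "\<And>n \<tau>. n \<ge> 1 \<Longrightarrow> \<tau> \<in> \<Omega>_on q (tree_V n) \<Longrightarrow>
      \<mu> {\<sigma> \<in> \<Omega> q. restrict \<sigma> (tree_V n) = \<tau>} = m n \<tau>"
  shows "\<mu> = extension"
proof (rule extensionalityI)
  show "\<mu> \<in> extensional (cylinder_sets q)" "extension \<in> extensional (cylinder_sets q)"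
    using \<mu> extension_prob by (simp_all add: padic_prob_measure_def)
  fix A assume "A \<in> cylinder_sets q"
  then obtain k where "cylinder_of_level q k A" by (auto simp: cylinder_sets_iff)
  then obtain n where n: "n \<ge> 1" and A: "cylinder_of_level q n A"
    using cylinder_of_level_mono[of q k A "Suc k"] by auto
  let ?R = "\<lambda>\<sigma>. restrict \<sigma> (tree_V n)"
  let ?cyl = "\<lambda>S. {\<sigma> \<in> \<Omega> q. ?R \<sigma> \<in> S}"
  have cyl: "?cyl S \<in> cylinder_sets q" for S
    by (auto simp: cylinder_sets_iff cylinder_of_level_def intro!: exI[of _ n])
  have add: "\<mu> (B \<union> C) = \<mu> B + \<mu> C"
    if "B \<in> cylinder_sets q" "C \<in> cylinder_sets q" "B \<inter> C = {}" for B C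
    using \<mu> that by (simp add: padic_prob_measure_def additive_def)
  have sum: "\<mu> (?cyl S) = (\<Sum>\<tau>\<in>S. m n \<tau>)" if "finite S" "S \<subseteq> \<Omega>_on q (tree_V n)" for S
    using that
  proof (induction rule: finite_induct)
    case empty
    have e: "{} \<in> cylinder_sets q" using cyl[of "{}"] by simp
    \<comment> \<open>The value 0 at the empty set comes from additivity by cancellation.\<close>
    have "\<mu> {} + \<mu> {} = \<mu> {} + 0"
      using add[OF e e Int_empty_left] by (metis Un_empty_left add_0_right)
    then show ?case by (simp only: add_left_cancel) simp
  next
    case (insert \<tau> S)
    have "?cyl (insert \<tau> S) = ?cyl {\<tau>} \<union> ?cyl S" by auto
    then have "\<mu> (?cyl (insert \<tau> S)) = \<mu> (?cyl {\<tau>}) + \<mu> (?cyl S)"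
      using add[OF cyl[of "{\<tau>}"] cyl[of S]] insert.hyps by auto
    also have "\<mu> (?cyl {\<tau>}) = m n \<tau>"
      using basic[OF n, of \<tau>] insert.prems by simp
    also have "\<mu> (?cyl S) = (\<Sum>\<tau>\<in>S. m n \<tau>)"
      using insert.IH insert.prems by blast
    finally show ?case
      using insert.hyps by (simp only: sum.insert not_False_eq_True)
  qed
  have sub: "?R ` A \<subseteq> \<Omega>_on q (tree_V n)"
    using A by (auto simp: cylinder_of_level_def intro: restrict_in_\<Omega>_on)
  have "A = ?cyl (?R ` A)"
    using A by (auto simp: cylinder_of_level_def)
  then have "\<mu> A = (\<Sum>\<tau>\<in>?R ` A. m n \<tau>)"
    using sum[OF finite_subset[OF sub] sub] by simp
  then show "\<mu> A = extension A"
    by (simp add: extension_eq[OF n A] level_sum_def)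
qed

end


subsection \<open>Boundary functions with a constant recursion factor\<close>

text \<open>The factor \<open>a\<close> depends neither on the vertex nor on the spin. The boundary
  function has no meaning at the root, so there only the nonvanishing of the first partition
  function is required.\<close>

locale constant_factor =
  fixes q :: nat and \<rho> a :: "'p::prime_card padic" and h :: "vertex \<Rightarrow> nat \<Rightarrow> 'p padic"
  assumes q_pos: "q > 0"
    and normalized: "\<And>x. x \<noteq> [] \<Longrightarrow> h x 0 = 1"
    and recursion: "\<And>x i. x \<noteq> [] \<Longrightarrow> i < q \<Longrightarrow> (\<Prod>c\<in>UNIV. child_sum q \<rho> (h (c # x)) i) = a * h x i"
    and root: "(\<Sum>i<q. \<Prod>c\<in>UNIV. child_sum q \<rho> (h [c]) i) \<noteq> 0"
    and a_nz: "a \<noteq> 0"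
begin

text \<open>Each of the 3^n vertices of the sphere \<open>tree_W n\<close> contributes one factor
  \<open>a\<close>.\<close>

lemma sum_boltzmann_weight:
  assumes n: "n \<ge> 1" and \<sigma>: "\<sigma> \<in> \<Omega>_on q (tree_V n)"
  shows "(\<Sum>\<omega>\<in>\<Omega>_on q (tree_W (Suc n)). boltzmann_weight \<rho> h (Suc n) (override_on \<sigma> \<omega> (tree_W (Suc n))))
     = a ^ 3 ^ n * boltzmann_weight \<rho> h n \<sigma>"
proof -
  have "(\<Prod>x\<in>tree_W n. \<Prod>c\<in>UNIV. child_sum q \<rho> (h (c # x)) (\<sigma> x)) = (\<Prod>x\<in>tree_W n. a * h x (\<sigma> x))"
  proof (rule prod.cong)
    fix x assume "x \<in> tree_W n"
    then have "x \<noteq> []" "\<sigma> x < q"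
      using n \<sigma> by (auto simp: tree_W_def \<Omega>_on_def tree_V_def)
    then show "(\<Prod>c\<in>UNIV. child_sum q \<rho> (h (c # x)) (\<sigma> x)) = a * h x (\<sigma> x)"
      by (rule recursion)
  qed simp
  then show ?thesis
    unfolding sum_boltzmann_weight_override
    by (simp add: boltzmann_weight_def prod.distrib card_tree_W)
qed

lemma partition_function_Suc:
  "n \<ge> 1 \<Longrightarrow> partition_function q \<rho> h (Suc n) = a ^ 3 ^ n * partition_function q \<rho> h n"
  unfolding partition_function_def sum_\<Omega>_on_tree_V_Suc
  by (simp add: sum_boltzmann_weight sum_distrib_left)

lemma partition_function_nz: "n \<ge> 1 \<Longrightarrow> partition_function q \<rho> h n \<noteq> 0"
proof (induction rule: dec_induct)
  case base
  then show ?case using root partition_function_1[of q \<rho> h] by simp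
next
  case (step n)
  then show ?case by (simp add: partition_function_Suc a_nz)
qed

sublocale consistent_family q "mu_fin q \<rho> h"
proof
  show "q > 0" by (rule q_pos)
  show "(\<Sum>\<omega>\<in>\<Omega>_on q (tree_W (Suc n)). mu_fin q \<rho> h (Suc n) (override_on \<sigma> \<omega> (tree_W (Suc n))))
      = mu_fin q \<rho> h n \<sigma>" if "n \<ge> 1" "\<sigma> \<in> \<Omega>_on q (tree_V n)" for n \<sigma>
    using that a_nz
    by (simp add: mu_fin_def sum_boltzmann_weight partition_function_Suc flip: sum_divide_distrib)
  show "(\<Sum>\<sigma>\<in>\<Omega>_on q (tree_V 1). mu_fin q \<rho> h 1 \<sigma>) = 1"
    using partition_function_nz[of 1]
    by (simp add: mu_fin_def partition_function_def flip: sum_divide_distrib)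
qed

lemma compatible: "compatible q \<rho> h"
  unfolding compatible_def
proof (intro allI impI ballI)
  fix n :: nat and \<sigma> assume n: "n \<ge> 2" and \<sigma>: "\<sigma> \<in> \<Omega>_on q (tree_V (n - 1))"
  from n obtain k where "n = Suc k" "k \<ge> 1" by (cases n) auto
  then show "(\<Sum>\<omega>\<in>\<Omega>_on q (tree_W n). mu_fin q \<rho> h n (override_on \<sigma> \<omega> (tree_W n)))
      = mu_fin q \<rho> h (n - 1) \<sigma>"
    using consistent \<sigma> by simp
qed

lemma quasi_gibbs_measure_iff: "quasi_gibbs_measure q \<rho> h \<mu> \<longleftrightarrow> \<mu> = extension"
  using normalized partition_function_nz compatible extension_prob extension_basic
    extension_unique[of \<mu>]
  unfolding quasi_gibbs_measure_def by blast

text \<open>The exact exponent of \<open>a\<close> is 3 + ... + 3^n. The weaker exponent n still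
  forces convergence to zero when the norm of \<open>a\<close> is less than 1.\<close>

lemma norm_partition_function_le:
  assumes "padic_norm a \<le> 1"
  shows "padic_norm (partition_function q \<rho> h (Suc n))
           \<le> padic_norm a ^ n * padic_norm (partition_function q \<rho> h 1)"
proof (induction n)
  case (Suc n)
  have "padic_norm (partition_function q \<rho> h (Suc (Suc n)))
      = padic_norm a ^ 3 ^ Suc n * padic_norm (partition_function q \<rho> h (Suc n))"
    by (simp add: partition_function_Suc padic_norm_mult padic_norm_power)
  also have "\<dots> \<le> padic_norm a ^ 1 * (padic_norm a ^ n * padic_norm (partition_function q \<rho> h 1))"
    using assms Suc by (intro mult_mono power_decreasing) auto
  finally show ?case by (simp add: mult.assoc)
qed simp

text \<open>By the normalization at spin 0 and the norm of \<rho>, the zero configuration has weight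
  of norm 1, so the norm of its measure is the inverse of that of the partition function.\<close>

lemma extension_unbounded:
  assumes \<rho>: "padic_norm \<rho> = 1" and a: "padic_norm a < 1"
  shows "\<not> bounded_measure (cylinder_sets q) extension"
proof
  assume "bounded_measure (cylinder_sets q) extension"
  then obtain b where b: "padic_norm (extension A) \<le> b" if "A \<in> cylinder_sets q" for A
    by (auto simp: bounded_measure_def bdd_above_def)
  let ?Z = "\<lambda>n. padic_norm (partition_function q \<rho> h n)"
  have Z: "?Z (Suc n) > 0" for n
    using partition_function_nz[of "Suc n"] padic_norm_nonneg padic_norm_eq_0_iff
    by (metis le_add1 less_eq_real_def plus_1_eq_Suc)
  have le: "1 \<le> b * (padic_norm a ^ n * ?Z 1)" for n
  proof -
    let ?\<tau> = "\<lambda>x\<in>tree_V (Suc n). 0 :: nat"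
    have \<tau>: "?\<tau> \<in> \<Omega>_on q (tree_V (Suc n))"
      using q_pos by (auto simp: \<Omega>_on_def)
    have "tree_W (Suc n) \<subseteq> tree_V (Suc n)" "[] \<notin> tree_W (Suc n)"
      by (auto simp: tree_V_def tree_W_def)
    then have "(\<Prod>x\<in>tree_W (Suc n). h x (?\<tau> x)) = 1"
      by (intro prod.neutral) (metis (no_types, lifting) normalized restrict_apply subsetD)
    then have "padic_norm (boltzmann_weight \<rho> h (Suc n) ?\<tau>) = 1"
      by (simp add: boltzmann_weight_def padic_norm_power \<rho>)
    moreover have "padic_norm (mu_fin q \<rho> h (Suc n) ?\<tau>) \<le> b"
      using extension_basic[OF _ \<tau>] b[of "{\<sigma> \<in> \<Omega> q. restrict \<sigma> (tree_V (Suc n)) = ?\<tau>}"]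
        cylinder_of_level_basic[of "Suc n" ?\<tau>]
      by (auto simp: cylinder_sets_iff)
    ultimately have 1: "1 \<le> b * ?Z (Suc n)"
      using Z[of n] by (simp add: mu_fin_def padic_norm_divide divide_le_eq)
    \<comment> \<open>The sign of \<open>b\<close> is needed to multiply the bound on the partition
      function by it.\<close>
    then have "b \<ge> 0" using Z[of n] by (smt (verit) mult_nonpos_nonneg)
    then show ?thesis
      using 1 mult_left_mono[OF norm_partition_function_le[of n], of b] a by linarith
  qed
  have "(\<lambda>n. b * (padic_norm a ^ n * ?Z 1)) \<longlonglongrightarrow> b * (0 * ?Z 1)"
    using a by (intro tendsto_intros LIMSEQ_realpow_zero) auto
  then have "1 \<le> b * (0 * ?Z 1)"
    by (rule LIMSEQ_le_const) (use le in auto)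
  then show False by simp
qed

end


subsection \<open>The invariant line\<close>

lemma sum_line_field:
  assumes "i0 < q"
  shows "(\<Sum>j<q. line_field i0 x y j) = x + of_nat q - (1 :: 'p::prime_card padic)"
proof -
  have "(\<Sum>j<q. line_field i0 x y j) = (\<Sum>j<q. (if j = i0 then x - 1 else 0) + 1)"
    by (intro sum.cong) (auto simp: line_field_def)
  then show ?thesis
    using assms by (simp add: sum.distrib)
qed

text \<open>The two values are the numerator and the denominator in the fixed point
  equation.\<close>

lemma child_sum_line_field:
  assumes "i0 < q" "i < q"
  shows "child_sum q \<rho> (line_field i0 x y) i
           = (if i = i0 then \<rho> * x + of_nat q - 1 else x + \<rho> + of_nat q - 2)"
  unfolding child_sum_eq[OF assms(2)] sum_line_field[OF assms(1)]
  by (simp add: line_field_def algebra_simps)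

text \<open>If the coordinate sum vanished, the numerator would be \<open>x\<close> times the
  denominator, so \<open>x = x ^ 3\<close>. Then \<open>x\<close> is 0, 1 or -1 and q = 1 - x is 1,
  0 or 2, which contradicts q \<ge> 3 in characteristic zero.\<close>

lemma fixed_point_root_nz:
  assumes "q \<ge> 3" and x: "fixed_point_solution q \<rho> (x :: 'p::prime_card padic)"
  shows "x + of_nat q - 1 \<noteq> 0"
proof
  assume eq: "x + of_nat q - 1 = 0"
  then have xq: "x = 1 - of_nat q" by (simp add: algebra_simps)
  have D: "x + \<rho> + of_nat q - 2 = \<rho> - 1"
    using eq by (simp add: algebra_simps)
  have N: "\<rho> * x + of_nat q - 1 = x * (\<rho> - 1)"
    by (simp add: xq algebra_simps)
  have "\<rho> - 1 \<noteq> 0" and "x = (x * (\<rho> - 1) / (\<rho> - 1)) ^ 3"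
    using x unfolding fixed_point_solution_def D N by auto
  then have "x = x ^ 3" by simp
  then have "x * (x - 1) * (x + 1) = 0" by (simp add: algebra_simps power3_eq_cube)
  then have "x = 0 \<or> x - 1 = 0 \<or> x + 1 = 0" by (simp only: mult_eq_0_iff disj_assoc)
  then have "of_nat q = (of_nat 1 :: 'p padic) \<or> of_nat q = (of_nat 0 :: 'p padic)
      \<or> of_nat q = (of_nat 2 :: 'p padic)"
    by (auto simp: xq algebra_simps)
  then show False
    using assms(1) by (simp only: padic_of_nat_eq_iff) auto
qed

text \<open>After clearing denominators the fixed point equation reads
  \<open>?N ^ 3 = ?D ^ 3 * x\<close>, so both kinds of coordinates are multiplied by
  \<open>?D ^ 3\<close>.\<close>

lemma constant_factor_line_field:
  assumes q: "q \<ge> 3" and i0: "i0 \<in> {1..<q}" and x: "fixed_point_solution q \<rho> x"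
  shows "constant_factor q \<rho> ((x + \<rho> + of_nat q - 2) ^ 3) (line_field i0 x)"
proof
  let ?D = "x + \<rho> + of_nat q - 2" and ?N = "\<rho> * x + of_nat q - 1"
  have D: "?D \<noteq> 0" and "x = (?N / ?D) ^ 3"
    using x by (auto simp: fixed_point_solution_def)
  then have N: "?N ^ 3 = ?D ^ 3 * x" by (simp add: field_simps)
  \<comment> \<open>The field is the same at all vertices, so \<open>y\<close> and \<open>z\<close>
    are independent. This lets the fact serve at the root too.\<close>
  have prod: "(\<Prod>c\<in>(UNIV :: 3 set). child_sum q \<rho> (line_field i0 x (c # y)) i) = ?D ^ 3 * line_field i0 x z i"
    if "i < q" for i y z
    using that i0 N by (simp add: child_sum_line_field line_field_def)
  show "q > 0" "line_field i0 x y 0 = 1" for y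
    using q i0 by (auto simp: line_field_def)
  show "(\<Prod>c\<in>UNIV. child_sum q \<rho> (line_field i0 x (c # y)) i) = ?D ^ 3 * line_field i0 x y i"
    if "i < q" for i y
    by (rule prod[OF that])
  have "(\<Sum>i<q. \<Prod>c\<in>UNIV. child_sum q \<rho> (line_field i0 x [c]) i)
      = ?D ^ 3 * (\<Sum>i<q. line_field i0 x [] i)"
    by (simp add: prod[where y = "[]" and z = "[]"] sum_distrib_left)
  then show "(\<Sum>i<q. \<Prod>c\<in>UNIV. child_sum q \<rho> (line_field i0 x [c]) i) \<noteq> 0"
    using D fixed_point_root_nz[OF q x] i0 by (simp add: sum_line_field)
  show "?D ^ 3 \<noteq> 0" using D by simp
qed

lemma padic_norm_line_denominator:
  assumes "padic_norm (of_nat q :: 'p::prime_card padic) < 1" "\<rho> \<in> Ep" "x \<in> Ep"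
  shows "padic_norm (x + \<rho> + of_nat q - (2 :: 'p padic)) < 1"
proof -
  have "x + \<rho> + of_nat q - 2 = (x - 1) + (\<rho> - 1) + of_nat q"
    by simp
  then show ?thesis
    using padic_norm_add[of "x - 1" "\<rho> - 1"] padic_norm_add[of "(x - 1) + (\<rho> - 1)" "of_nat q"]
      Ep_norm_diff_1[of x] Ep_norm_diff_1[of \<rho>] assms
    by (smt (verit))
qed

lemma ti_gibbs_line_field_iff:
  assumes "\<rho> \<in> Ep" "x \<in> Ep"
  shows "ti_gibbs_measure q \<rho> (line_field i0 x) \<mu> \<longleftrightarrow> quasi_gibbs_measure q \<rho> (line_field i0 x) \<mu>"
proof -
  have "translation_invariant q (line_field i0 x)"
    by (auto simp: translation_invariant_def line_field_def intro!: exI[of _ "\<lambda>i. if i = i0 then x else 1"])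
  then show ?thesis
    using assms by (auto simp: ti_gibbs_measure_def gibbs_measure_def line_field_def)
qed


subsection \<open>Boundary functions of total sum zero\<close>

text \<open>
  The vectors \<open>e\<^sub>0 - e\<^sub>k\<close> have coordinate sum zero, so \<open>child_sum\<close> only multiplies them by
  \<open>\<rho> - 1\<close>, and their coordinates equal their cubes. The label \<open>k\<close> may thus be chosen
  separately on the three subtrees at the root; with a single label throughout, the partition
  functions would be zero.
\<close>

definition difference_field :: "(3 \<Rightarrow> nat) \<Rightarrow> vertex \<Rightarrow> nat \<Rightarrow> 'p::prime_card padic" where
  "difference_field K x i = (if i = 0 then 1 else if i = K (last x) then - 1 else 0)"

lemma child_sum_difference_field:
  fixes \<rho> :: "'p::prime_card padic"
  assumes "K (last x) \<in> {1..<q}" "i < q"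
  shows "child_sum q \<rho> (difference_field K x) i = (\<rho> - 1) * difference_field K x i"
proof -
  let ?k = "K (last x)"
  have "(\<Sum>j<q. difference_field K x j :: 'p padic)
      = (\<Sum>j<q. (if j = 0 then 1 else 0) + (if j = ?k then - 1 else 0))"
    using assms(1) by (intro sum.cong) (auto simp: difference_field_def)
  also have "\<dots> = 0"
    using assms(1) by (simp add: sum.distrib)
  finally show ?thesis
    using child_sum_eq[OF assms(2), of \<rho> "difference_field K x"] by simp
qed

text \<open>At the root, spin 0 contributes (\<rho> - 1)^3. Any other spin differs from the label of
  some subtree because two labels are distinct, and that subtree gives a factor 0.\<close>

lemma constant_factor_difference_field:
  assumes K: "\<And>c. K c \<in> {1..<q}" and K12: "K c1 \<noteq> K c2" and \<rho>: "\<rho> \<noteq> 1"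
  shows "constant_factor q \<rho> ((\<rho> - 1) ^ 3) (difference_field K)"
proof
  show q: "q > 0" using K[of c1] by simp
  show "difference_field K x 0 = 1" for x
    by (simp add: difference_field_def)
  show "(\<Prod>c\<in>UNIV. child_sum q \<rho> (difference_field K (c # x)) i) = (\<rho> - 1) ^ 3 * difference_field K x i"
    if "x \<noteq> []" "i < q" for x i
    \<comment> \<open>For nonempty \<open>x\<close>, the child \<open>c # x\<close> has the same
      last entry and hence the same label; 1, -1 and 0 equal their cubes.\<close>
    using that K by (simp add: child_sum_difference_field)
      (simp add: difference_field_def power3_eq_cube algebra_simps)
  have "(\<Prod>c\<in>UNIV. child_sum q \<rho> (difference_field K [c]) i) = (if i = 0 then (\<rho> - 1) ^ 3 else 0)"
    if "i < q" for i
  proof (cases "i = 0")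
    case True
    then show ?thesis
      using that K by (simp add: child_sum_difference_field) (simp add: difference_field_def)
  next
    case False
    obtain c where "K c \<noteq> i" using K12 by metis
    then have "child_sum q \<rho> (difference_field K [c]) i = 0"
      using that K False by (simp add: child_sum_difference_field) (simp add: difference_field_def)
    then show ?thesis using False by (auto intro!: prod_zero)
  qed
  then show "(\<Sum>i<q. \<Prod>c\<in>UNIV. child_sum q \<rho> (difference_field K [c]) i) \<noteq> 0"
    using q \<rho> by simp
  show "(\<rho> - 1) ^ 3 \<noteq> 0" using \<rho> by simp
qed

text \<open>A single nonzero spin placed at one child of the root detects the label of the subtree
  below that child.\<close>

lemma boltzmann_weight_difference_field:
  assumes "\<rho> \<noteq> 0"
  shows "boltzmann_weight \<rho> (difference_field K) 1 (\<lambda>x\<in>tree_V 1. if x = [c] then k else 0) \<noteq> 0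
           \<longleftrightarrow> k = 0 \<or> k = K c"
proof -
  have W: "tree_W 1 = range (\<lambda>c. [c])"
    by (auto simp: tree_W_def length_Suc_conv)
  have "[d] \<in> tree_V 1" for d
    by (auto simp: tree_V_def tree_W_def)
  then show ?thesis
    using assms unfolding boltzmann_weight_def W
    by (auto simp: difference_field_def simp del: One_nat_def)
qed

lemma phase_transition_if_norm_diff_1_less_1:
  assumes q: "q \<ge> 3" and \<rho>: "\<rho> \<noteq> 1" "padic_norm \<rho> = 1" "padic_norm (\<rho> - 1) < 1"
  shows "phase_transition q \<rho>"
proof -
  \<comment> \<open>Below child 1 the label is k, below the other two it is 3 - k. For k = 1 and k =
    2 both labels 1 and 2 occur, and they are valid spins as q \<ge> 3.\<close>
  define K where "K = (\<lambda>k c :: 3. if c = 1 then k else 3 - k :: nat)"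
  interpret k1: constant_factor q \<rho> "(\<rho> - 1) ^ 3" "difference_field (K 1)"
    by (rule constant_factor_difference_field[of _ _ 1 2]) (use q \<rho> in \<open>auto simp: K_def\<close>)
  interpret k2: constant_factor q \<rho> "(\<rho> - 1) ^ 3" "difference_field (K 2)"
    by (rule constant_factor_difference_field[of _ _ 1 2]) (use q \<rho> in \<open>auto simp: K_def\<close>)
  have \<rho>0: "\<rho> \<noteq> 0" using \<rho> by auto
  \<comment> \<open>Spin 1 at child 1 agrees with its label in the first field but not in the
    second, so exactly one of the two measures vanishes on this cylinder.\<close>
  let ?\<tau> = "\<lambda>x\<in>tree_V 1. if x = [1] then 1 else 0 :: nat"
  let ?A = "{\<sigma> \<in> \<Omega> q. restrict \<sigma> (tree_V 1) = ?\<tau>}"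
  have \<tau>: "?\<tau> \<in> \<Omega>_on q (tree_V 1)"
    using q by (auto simp: \<Omega>_on_def)
  have "k1.extension ?A \<noteq> 0"
    using boltzmann_weight_difference_field[OF \<rho>0, of "K 1" 1 1] k1.partition_function_nz[of 1]
    unfolding k1.extension_basic[OF order.refl \<tau>] mu_fin_def by (simp add: K_def)
  moreover have "k2.extension ?A = 0"
    using boltzmann_weight_difference_field[OF \<rho>0, of "K 2" 1 1]
    unfolding k2.extension_basic[OF order.refl \<tau>] mu_fin_def by (simp add: K_def)
  ultimately have "k1.extension \<noteq> k2.extension" by metis
  moreover have "\<not> bounded_measure (cylinder_sets q) k1.extension"
    by (rule k1.extension_unbounded) (use \<rho> in \<open>auto simp: padic_norm_power power_less_one_iff\<close>)
  moreover have "generalized_quasi_gibbs q \<rho> k1.extension" "generalized_quasi_gibbs q \<rho> k2.extension"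
    unfolding generalized_quasi_gibbs_def
    using k1.quasi_gibbs_measure_iff k2.quasi_gibbs_measure_iff by blast+
  ultimately show ?thesis
    unfolding phase_transition_def by blast
qed

text \<open>At \<rho> = 1 the inner spins decouple from the boundary and compatibility forces
  uniform distributions, so there is only one measure; hence the condition \<rho> \<noteq> 1 for the
  phase transition. The hypothesis \<open>fixed_point_solution\<close> excludes vanishing
  denominators, such as x = 1 with \<rho> = 1 - q.\<close>

theorem theorem5p1:
  fixes q i0 :: nat and \<rho> :: "'p::prime_card padic"
  assumes "CARD('p) > 3"
    and "q \<ge> 3"
    and "padic_norm (of_nat q :: 'p padic) \<le> 1 / real CARD('p) ^ 3"
    and "\<rho> \<in> Ep"
    and "padic_norm (\<rho> - 1) \<le> 1 / real CARD('p) ^ 3"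
    and "i0 \<in> {1..<q}"
  shows "(\<forall>x. (x = 1 \<or> x \<in> Ep \<and> cubic_root q \<rho> x) \<and> fixed_point_solution q \<rho> x \<longrightarrow>
            (\<exists>!\<mu>. ti_gibbs_measure q \<rho> (line_field i0 x) \<mu>) \<and>
            (\<forall>\<mu>. ti_gibbs_measure q \<rho> (line_field i0 x) \<mu> \<longrightarrow>
                   \<not> bounded_measure (cylinder_sets q) \<mu>))
         \<and> (\<rho> \<noteq> 1 \<longrightarrow> phase_transition q \<rho>)"
proof (intro conjI allI impI)
  have \<rho>: "padic_norm \<rho> = 1" "padic_norm (\<rho> - 1) < 1"
    using assms(4) by (auto intro: Ep_norm Ep_norm_diff_1)
  have "1 / real CARD('p) ^ 3 < 1"
    using assms(1) by (simp add: divide_less_eq)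
  with assms(3) have q: "padic_norm (of_nat q :: 'p padic) < 1" by linarith
  show "phase_transition q \<rho>" if "\<rho> \<noteq> 1"
    using phase_transition_if_norm_diff_1_less_1 assms(2) that \<rho> by blast
  fix x assume x: "(x = 1 \<or> x \<in> Ep \<and> cubic_root q \<rho> x) \<and> fixed_point_solution q \<rho> x"
  then have xEp: "x \<in> Ep" by auto
  interpret constant_factor q \<rho> "(x + \<rho> + of_nat q - 2) ^ 3" "line_field i0 x"
    using constant_factor_line_field assms x by blast
  \<comment> \<open>Existence, uniqueness and unboundedness all reduce to the single measure
    \<open>extension\<close>.\<close>
  have iff: "ti_gibbs_measure q \<rho> (line_field i0 x) \<mu> \<longleftrightarrow> \<mu> = extension" for \<mu>
    using ti_gibbs_line_field_iff[OF assms(4) xEp] quasi_gibbs_measure_iff by blast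
  show "\<exists>!\<mu>. ti_gibbs_measure q \<rho> (line_field i0 x) \<mu>" by (simp add: iff)
  have "padic_norm ((x + \<rho> + of_nat q - 2) ^ 3) < 1"
    using padic_norm_line_denominator[OF q assms(4) xEp]
    by (simp add: padic_norm_power power_less_one_iff)
  then show "\<not> bounded_measure (cylinder_sets q) \<mu>" if "ti_gibbs_measure q \<rho> (line_field i0 x) \<mu>" for \<mu>
    using extension_unbounded[OF \<rho>(1)] that iff by metis
qed

end
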